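(* Assume that the following conditions hold. (A1) There are constants $C\ge 0$, $C'\ge 0$ and $K>0$ such that (i) $\max_{i\in\{1,2,3\}}|\partial^i b(x)|\le K(1+|x|^{C})$ for all $x\in\mathbb{R}$; (ii) $E\big[|Y_j|^3\,\big|\,\mathcal{F}_{j-1}\vee\sigma(X_j)\big]\le K(1+|X_j|^{C'})$ a.s. for every $j\in\mathbb{N}$; (iii) $\sup_{j\in\mathbb{N}}E\big[|X_j|^{3C+C'+3}\big]<\infty$. (A2) There is a measurable function $F:\mathbb{R}^p\to\mathbb{R}$ with $E[Y_j\mid\mathcal{F}_{j-1}\vee\sigma(X_j)]=F(X_j)$ for every $j\in\mathbb{N}$. (A3) With $\zeta_j=(X_j,Y_j)$ and $\alpha(k):=\sup_{j\in\mathbb{N}}\sup\{|P[A\cap B]-P[A]P[B]| : A\in\sigma(\zeta_i;i\le j),\ B\in\sigma(\zeta_i;i\ge j+k)\}$, there is $c>0$ such that $\alpha(k)\le c^{-1}e^{-ck}$ for all $k\in\mathbb{N}$. (A4) There is a non-degenerate probability measure $\nu$ on $\mathbb{R}^p$ such that, for every $\theta\in\Theta$, as $n\to\infty$, (i) $\frac1n\sum_{j=1}^n\big(F(X_j)X_j'\theta-b(X_j'\theta)\big)-\int\big(F(x)x'\theta-b(x'\theta)\big)\nu(dx)\to0$ in probability; (ii) $\frac1n\sum_{j=1}^n\partial^2b(X_j'\theta)X_jX_j'-\int\partial^2b(x'\theta)xx'\,\nu(dx)\to0$ in probability. (A5) There is a function $\underline{b}:\mathbb{R}^p\to(0,\infty)$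 such that (i) $\inf_{\theta\in\Theta}\partial^2b(x'\theta)\ge\underline{b}(x)$ for every $x$; (ii) for some constant $\lambda_0>0$, $\limsup_{n\to\infty}P\big[\lambda_{\min}\big(\frac1n\sum_{j=1}^n\underline{b}(X_j)X_jX_j'\big)<\lambda_0\big]=0$. (A6) $\frac{1}{\sqrt n}\sum_{j=1}^n\big(F(X_j)-\partial b(X_j'\theta_0)\big)X_j=O_p(1)$, where $\theta_0$ is the optimal parameter. Let $\pi$ be a prior probability density on $\Theta$ such that (P1) $\pi(\theta_0)>0$ and $\sup_{\theta\in\Theta}\pi(\theta)<\infty$; (P2) for every $M>0$, $\sup_{|u|<M}\big|\pi\big(\theta_0+\frac{u}{\sqrt n}\big)-\pi(\theta_0)\big|\to0$ as $n\to\infty$; (P3) $\log\pi(\hat\theta_n)-\log\pi(\theta_0)=o_p(1)$. Then, as $n\to\infty$, $$\log\Big(\int_\Theta\exp\{\mathbb{H}_n(\theta)\}\pi(\theta)\,d\theta\Big)=\sum_{j=1}^n\big(Y_jX_j'\hat\theta_n-b(X_j'\hat\theta_n)\big)-\frac p2\log n+\frac p2\log(2\pi)-\frac12\log\det\Big(\frac1n\sum_{j=1}^n\partial^2b(X_j'\hat\theta_n)X_jX_j'\Big)+\log\pi(\hat\theta_n)+o_p(1)$$ $$=\sum_{j=1}^n\big(Y_jX_j'\hat\theta_n-b(X_j'\hat\theta_n)\big)+\frac p2\log(2\pi)-\frac12\log\det\Big(\sum_{j=1}^n\partial^2b(X_j'\hat\theta_n)X_jX_j'\Big)+\log\pi(\hat\theta_n)+o_p(1),$$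 where in $\log(2\pi)$ the symbol $\pi$ is the numerical constant.
   Context: On a probability space, $Y_1,Y_2,\dots$ are real random variables and $X_1,X_2,\dots$ are $\mathbb{R}^p$-valued random (column) vectors; $'$ denotes transpose and $|\cdot|$ the Euclidean norm. $\mathcal{F}_j=\sigma(Y_i,X_i;i\le j)$, with $\mathcal{F}_0$ trivial. $\Theta\subset\mathbb{R}^p$ is a bounded convex domain (open set). $b:\mathbb{R}\to\mathbb{R}$ is a sufficiently smooth (at least three times continuously differentiable) convex function, and $\partial^ib$ is its $i$-th derivative. $\lambda_{\min}(\cdot)$ is the smallest eigenvalue of a symmetric matrix. The logarithmic quasi-likelihood function (of a possibly misspecified generalized linear model) is $\mathbb{H}_n(\theta)=\sum_{j=1}^n\big(Y_jX_j'\theta-b(X_j'\theta)\big)$, $\theta\in\Theta$. The quasi-maximum likelihood estimator (QMLE) $\hat\theta_n$ is any ($\Theta$-valued, random) maximizer: $\hat\theta_n\in\mathrm{argmax}_{\theta\in\Theta}\mathbb{H}_n(\theta)$. With $F$ and $\nu$ as in the claim, put $\mathbb{H}_0(\theta)=\int\big(F(x)x'\theta-b(x'\theta)\big)\nu(dx)$; the optimal parameter $\theta_0\in\Theta$ is the unique maximizer of $\mathbb{H}_0$ over $\Theta$: $\{\theta_0\}=\mathrm{argmax}_{\theta\in\Theta}\mathbb{H}_0(\theta)$. *)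

theory Defs
  imports "HOL-Probability.Probability"
begin

text \<open>Only here because \<open>0 powr 0 = 0\<close> in the library, whereas the usual \<open>0 ^ 0 = 1\<close> is meant.\<close>

definition rpow :: "real \<Rightarrow> real \<Rightarrow> real" where
  "rpow x a = (if a = 0 then 1 else x powr a)"

text \<open>Logarithm with \<open>log 0 = -\<infinity>\<close>; the library has \<open>ln 0 = 0\<close>.\<close>

definition eln :: "real \<Rightarrow> ereal" where
  "eln x = (if 0 < x then ereal (ln x) else - \<infinity>)"

definition continuously_differentiable :: "nat \<Rightarrow> (real \<Rightarrow> real) \<Rightarrow> bool" where
  "continuously_differentiable k f \<longleftrightarrow>
     (\<forall>i<k. \<forall>x. ((deriv ^^ i) f) field_differentiable (at x)) \<and>
     continuous_on UNIV ((deriv ^^ k) f)"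

definition outer :: "real ^ 'p \<Rightarrow> real ^ 'p ^ 'p" where
  "outer x = (\<chi> i j. x $ i * x $ j)"

text \<open>Meaningful for matrices that have a smallest real eigenvalue, in particular for all
  symmetric ones.\<close>

definition lambda_min :: "real ^ 'p ^ 'p \<Rightarrow> real" where
  "lambda_min A = (LEAST l. \<exists>v. v \<noteq> 0 \<and> A *v v = l *\<^sub>R v)"

text \<open>For \<open>I = {}\<close> the generated \<open>\<sigma>\<close>-algebra is the trivial one.\<close>

definition generated :: "'w measure \<Rightarrow> (nat \<Rightarrow> 'w \<Rightarrow> 'b::topological_space) \<Rightarrow> nat set \<Rightarrow> 'w measure" where
  "generated M Z I = sigma (space M) (\<Union>i\<in>I. {Z i -` B \<inter> space M | B. B \<in> sets borel})"

definition zeta :: "(nat \<Rightarrow> 'w \<Rightarrow> real ^ 'p) \<Rightarrow> (nat \<Rightarrow> 'w \<Rightarrow> real) \<Rightarrow> nat \<Rightarrow> 'w \<Rightarrow> (real ^ 'p) \<times> real" where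
  "zeta X Y i \<omega> = (X i \<omega>, Y i \<omega>)"

text \<open>\<open>pre_response M X Y j\<close> is \<open>\<F>\<^sub>j\<^sub>-\<^sub>1 \<or> \<sigma>(X\<^sub>j)\<close>, for \<open>j \<ge> 1\<close>; observations are numbered from 1.\<close>

definition pre_response ::
  "'w measure \<Rightarrow> (nat \<Rightarrow> 'w \<Rightarrow> real ^ 'p) \<Rightarrow> (nat \<Rightarrow> 'w \<Rightarrow> real) \<Rightarrow> nat \<Rightarrow> 'w measure" where
  "pre_response M X Y j =
     sigma (space M) (sets (generated M (zeta X Y) {1..j - 1}) \<union> sets (generated M X {j}))"

definition mixing_coeff :: "'w measure \<Rightarrow> (nat \<Rightarrow> 'w \<Rightarrow> 'b::topological_space) \<Rightarrow> nat \<Rightarrow> real" where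
  "mixing_coeff M Z k =
     (SUP j\<in>{1..}. SUP (A, B)\<in>sets (generated M Z {1..j}) \<times> sets (generated M Z {j + k..}).
        \<bar>measure M (A \<inter> B) - measure M A * measure M B\<bar>)"

text \<open>Not a point mass.\<close>

definition nondegenerate :: "(real ^ 'p) measure \<Rightarrow> bool" where
  "nondegenerate \<nu> \<longleftrightarrow> \<not> (\<exists>a. measure \<nu> {a} = 1)"

text \<open>The values are extended reals so that a remainder containing \<open>log 0\<close> counts as large.\<close>

definition small_oP :: "'w measure \<Rightarrow> (nat \<Rightarrow> 'w \<Rightarrow> ereal) \<Rightarrow> bool" where
  "small_oP M Z \<longleftrightarrow>
     (\<forall>\<epsilon>::real. \<epsilon> > 0 \<longrightarrow> (\<lambda>n. measure M {\<omega> \<in> space M. ereal \<epsilon> < \<bar>Z n \<omega>\<bar>}) \<longlonglongrightarrow> 0)"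

definition big_OP :: "'w measure \<Rightarrow> (nat \<Rightarrow> 'w \<Rightarrow> 'b::real_normed_vector) \<Rightarrow> bool" where
  "big_OP M Z \<longleftrightarrow>
     (\<forall>\<epsilon>>0. \<exists>K. \<forall>\<^sub>F n in sequentially. measure M {\<omega> \<in> space M. K < norm (Z n \<omega>)} < \<epsilon>)"

definition quasi_loglik ::
  "(real \<Rightarrow> real) \<Rightarrow> (nat \<Rightarrow> 'w \<Rightarrow> real ^ 'p) \<Rightarrow> (nat \<Rightarrow> 'w \<Rightarrow> real) \<Rightarrow> nat \<Rightarrow> 'w \<Rightarrow> real ^ 'p \<Rightarrow> real" where
  "quasi_loglik b X Y n \<omega> \<theta> = (\<Sum>j=1..n. Y j \<omega> * (X j \<omega> \<bullet> \<theta>) - b (X j \<omega> \<bullet> \<theta>))"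

definition limit_loglik ::
  "(real \<Rightarrow> real) \<Rightarrow> (real ^ 'p \<Rightarrow> real) \<Rightarrow> (real ^ 'p) measure \<Rightarrow> real ^ 'p \<Rightarrow> real" where
  "limit_loglik b F \<nu> \<theta> = (\<integral>x. F x * (x \<bullet> \<theta>) - b (x \<bullet> \<theta>) \<partial>\<nu>)"

definition obs_info ::
  "(real \<Rightarrow> real) \<Rightarrow> (nat \<Rightarrow> 'w \<Rightarrow> real ^ 'p) \<Rightarrow> nat \<Rightarrow> 'w \<Rightarrow> real ^ 'p \<Rightarrow> real ^ 'p ^ 'p" where
  "obs_info b X n \<omega> \<theta> = (\<Sum>j=1..n. (deriv ^^ 2) b (X j \<omega> \<bullet> \<theta>) *\<^sub>R outer (X j \<omega>))"

definition density_on :: "(real ^ 'p) set \<Rightarrow> (real ^ 'p \<Rightarrow> real) \<Rightarrow> bool" where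
  "density_on \<Theta> f \<longleftrightarrow>
     set_borel_measurable lborel \<Theta> f \<and> (\<forall>\<theta>\<in>\<Theta>. 0 \<le> f \<theta>) \<and> (LINT \<theta>:\<Theta>|lborel. f \<theta>) = 1"

end

theory Submission
  imports Defs
begin

text \<open>
  Since \<open>\<theta>hat\<close> is an interior maximiser, the score vanishes there and
  \<open>H\<^sub>n(\<theta>hat) - H\<^sub>n(\<theta>hat + v)\<close> is a sum of Bregman distances of \<open>b\<close>. The bound \<open>\<partial>\<^sup>2b \<ge> b_low\<close> on
  \<open>\<Theta>\<close> together with (A5) makes this sum at least \<open>n \<lambda>\<^sub>0 \<bar>v\<bar>\<^sup>2 / 2\<close> on all of \<open>\<Theta>\<close>, and the bound
  on \<open>\<partial>\<^sup>3b\<close> makes it \<open>n/2\<close> times the quadratic form of the normalised observed information up to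
  \<open>O\<^sub>p(n \<bar>v\<bar>\<^sup>3)\<close>. Applied at \<open>\<theta>\<^sub>0\<close>, the lower bound gives
  \<open>\<bar>\<theta>hat - \<theta>\<^sub>0\<bar> \<le> 2 \<bar>score(\<theta>\<^sub>0)\<bar> / (n \<lambda>\<^sub>0)\<close>, and the score at \<open>\<theta>\<^sub>0\<close> is \<open>O\<^sub>p(\<surd>n)\<close>: it is a martingale with
  bounded second moments of the increments plus the term controlled by (A6). After the substitution
  \<open>v = u / \<surd>n\<close> the integrand is dominated by a Gaussian and, uniformly on balls, close to
  \<open>\<pi>(\<theta>\<^sub>0)\<close> times the Gaussian of the observed information. Apart from the bound on the score
  these estimates are deterministic, with rates depending only on constants that are bounded with
  probability close to 1.
\<close>

section \<open>Quadratic forms and Gaussian integrals\<close>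

text \<open>The expansion is centred at the random maximiser, whereas the prior is controlled only
  around \<open>\<theta>\<^sub>0\<close>; a distance of order 1/sqrt(n) places both in one window of
  that size. The integral is compared with the Gaussian integral of the observed information of the
  same sample, not with that of a limit matrix. A comparison sample by sample asks for a form of
  dominated convergence whose constants depend on the dominating function alone. Taking logarithms
  asks in addition for a lower bound on the Gaussian integral, hence an upper bound k on the
  information beside the lower bound l. The estimates hold for all outcomes and all maximisers
  satisfying \<open>regular\<close>, so probability enters only in showing that
  \<open>regular\<close> fails on a set of small measure, with constants chosen after that measure
  is prescribed. The determinant comes from exact Gaussian integration, where a matrix B with B'AB =
  1 plays the role of an inverse square root.\<close>

lemma symmetric_inner_commute:
  fixes A :: "real ^ 'p ^ 'p"
  assumes "transpose A = A"
  shows "x \<bullet> (A *v y) = y \<bullet> (A *v x)"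
  by (metis assms dot_lmul_matrix inner_commute transpose_matrix_vector)

lemma continuous_on_matrix_vector_mult [continuous_intros]:
  fixes A :: "real ^ 'm ^ 'n"
  shows "continuous_on S ((*v) A)"
  by (intro linear_continuous_on) (simp add: linear_linear)

lemma borel_measurable_quadratic_form [measurable]:
  fixes A :: "real ^ 'p ^ 'p"
  shows "(\<lambda>x. x \<bullet> (A *v x)) \<in> borel_measurable borel"
  by (intro borel_measurable_continuous_onI continuous_intros)

text \<open>First-order condition at the minimum t = 0 of a nonnegative quadratic polynomial: at t =
  -a/d with d > |c| a positive linear coefficient would make the value negative. It is applied with
  a = |w|^2, where nonnegativity of a is automatic.\<close>

lemma nonneg_quadratic_linear_coeff_nonpos:
  fixes a c :: real
  assumes "\<And>t. 0 \<le> 2 * t * a + t\<^sup>2 * c" "0 \<le> a"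
  shows "a = 0"
proof (rule ccontr)
  assume "a \<noteq> 0"
  with assms have a: "a > 0" by auto
  define d where "d = \<bar>c\<bar> + 1"
  have d: "d > 0" "c < d" by (auto simp: d_def)
  have "0 \<le> 2 * (- a / d) * a + (- a / d)\<^sup>2 * c" by (rule assms)
  also have "\<dots> = (a\<^sup>2 / d\<^sup>2) * (c - 2 * d)" using d
    by (simp add: power2_eq_square field_simps)
  also have "\<dots> < 0" using a d by (intro mult_pos_neg) auto
  finally show False by simp
qed

text \<open>By compactness the form has a minimiser on the unit sphere, and this minimiser is an
  eigenvector. Its eigenvalue lies below all others, so the \<open>LEAST\<close> in
  \<open>lambda_min\<close> is attained and equals the minimum.\<close>

lemma lambda_min_le_quadratic_form:
  fixes A :: "real ^ 'p ^ 'p"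
  assumes sym: "transpose A = A"
  shows "lambda_min A * (v \<bullet> v) \<le> v \<bullet> (A *v v)"
proof -
  let ?q = "\<lambda>v. v \<bullet> (A *v v)"
  have cont: "continuous_on (sphere 0 1) ?q"
    by (intro continuous_intros linear_continuous_on) (simp add: linear_linear)
  have "sphere (0::real^'p) 1 \<noteq> {}"
    using sphere_eq_empty[of "0::real^'p" 1] by auto
  then obtain v0 where v0: "norm v0 = 1" and min0: "\<And>v. norm v = 1 \<Longrightarrow> ?q v0 \<le> ?q v"
    using continuous_attains_inf[OF compact_sphere _ cont] by (auto simp: dist_norm)
  define \<mu> where "\<mu> = ?q v0"
  have min: "\<mu> * (v \<bullet> v) \<le> ?q v" for v
  proof (cases "v = 0")
    case False
    have "\<mu> \<le> ?q (v /\<^sub>R norm v)" unfolding \<mu>_def using False by (intro min0) auto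
    also have "\<dots> = ?q v / (v \<bullet> v)"
      by (simp add: matrix_vector_mult_scaleR power2_norm_eq_inner[symmetric] power2_eq_square
          field_simps)
    finally show ?thesis using False by (simp add: pos_le_divide_eq)
  qed simp
  \<comment> \<open>The residual \<open>w\<close> is orthogonal to \<open>v0\<close>. Moving from
    \<open>v0\<close> along \<open>w\<close> changes the nonnegative form q(v) - \<mu> |v|^2 by 2 t
    |w|^2 to first order, so \<open>w\<close> must vanish.\<close>
  define w where "w = A *v v0 - \<mu> *\<^sub>R v0"
  have wv0: "w \<bullet> v0 = 0"
    using v0 by (simp add: w_def inner_diff_left \<mu>_def inner_commute[of "A *v v0"] norm_eq_1)
  have "w \<bullet> w = 0"
  proof (rule nonneg_quadratic_linear_coeff_nonpos[of _ "?q w - \<mu> * (w \<bullet> w)"])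
    fix t :: real
    have Av0: "A *v v0 = w + \<mu> *\<^sub>R v0" by (simp add: w_def)
    have *: "v0 \<bullet> (A *v w) = w \<bullet> w"
      using symmetric_inner_commute[OF sym, of v0 w] wv0 by (simp add: Av0 inner_add_right)
    have "0 \<le> ?q (v0 + t *\<^sub>R w) - \<mu> * ((v0 + t *\<^sub>R w) \<bullet> (v0 + t *\<^sub>R w))" using min by simp
    also have "\<dots> = 2 * t * (w \<bullet> w) + t\<^sup>2 * (?q w - \<mu> * (w \<bullet> w))"
      using wv0 *
      by (simp add: matrix_vector_right_distrib matrix_vector_mult_scaleR inner_add_left inner_add_right
          Av0 inner_commute[of v0 w] power2_eq_square algebra_simps)
    finally show "0 \<le> 2 * t * (w \<bullet> w) + t\<^sup>2 * (?q w - \<mu> * (w \<bullet> w))" .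
  qed simp
  then have ev: "A *v v0 = \<mu> *\<^sub>R v0" by (simp add: w_def)
  have "lambda_min A = \<mu>" unfolding lambda_min_def
  proof (rule Least_equality)
    show "\<exists>v. v \<noteq> 0 \<and> A *v v = \<mu> *\<^sub>R v" using ev v0 by (intro exI[of _ v0]) auto
    fix l assume "\<exists>v. v \<noteq> 0 \<and> A *v v = l *\<^sub>R v"
    then obtain v where "v \<noteq> 0" "A *v v = l *\<^sub>R v" by auto
    then show "\<mu> \<le> l" using min[of v] by simp
  qed
  with min show ?thesis by simp
qed

text \<open>The columns of B form an orthonormal basis for the inner product u . Av. Such a B serves
  as an inverse square root of A: the substitution x = By turns the form into |y|^2, and the
  determinant of the identity gives det A (det B)^2 = 1.\<close>

lemma ex_orthonormal_basis_matrix: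
  fixes A :: "real ^ 'p ^ 'p"
  assumes sym: "transpose A = A" and pos: "\<And>v. v \<noteq> 0 \<Longrightarrow> 0 < v \<bullet> (A *v v)"
  obtains B :: "real ^ 'p ^ 'p" where "transpose B ** A ** B = mat 1"
proof -
  define Q where "Q S \<longleftrightarrow> (\<forall>u\<in>S. \<forall>v\<in>S. u \<bullet> (A *v v) = (if u = v then 1 else 0))" for S
  have ind: "independent S" if S: "Q S" for S
    unfolding independent_explicit_module
  proof (intro allI impI)
    fix T u v assume T: "finite T" "T \<subseteq> S" and 0: "(\<Sum>v\<in>T. u v *\<^sub>R v) = 0" and v: "v \<in> T"
    have "0 = (\<Sum>v\<in>T. u v *\<^sub>R v) \<bullet> (A *v v)" using 0 by simp
    also have "\<dots> = (\<Sum>x\<in>T. (if x = v then u x else 0))"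
      unfolding inner_sum_left
    proof (rule sum.cong[OF refl])
      fix x assume "x \<in> T"
      with T v have "x \<in> S" "v \<in> S" by auto
      with S have "x \<bullet> (A *v v) = (if x = v then 1 else 0)" unfolding Q_def by blast
      then show "u x *\<^sub>R x \<bullet> (A *v v) = (if x = v then u x else 0)" by simp
    qed
    also have "\<dots> = u v" using T v by simp
    finally show "u v = 0" by simp
  qed
  then have bd: "finite S \<and> card S \<le> CARD('p)" if "Q S" for S
    using independent_bound[of S] that by auto
  have "Q {}" by (simp add: Q_def)
  \<comment> \<open>A maximal A-orthonormal set is a basis: otherwise a vector orthogonal to its image under A extends it.\<close>
  then obtain S where S: "Q S" and max: "\<And>T. Q T \<Longrightarrow> card T \<le> card S"
    using ex_has_greatest_nat[of Q "{}" card "Suc CARD('p)"] bd by (meson le_imp_less_Suc)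
  have fS: "finite S" using bd S by auto
  have "card S = CARD('p)"
  proof (rule ccontr)
    assume "card S \<noteq> CARD('p)"
    then have "card S < CARD('p)" using bd S by force
    then have "dim ((*v) A ` S) < DIM(real^'p)"
      using dim_le_card'[of "(*v) A ` S"] card_image_le[OF fS, of "(*v) A"] fS by simp
    then obtain v where v: "v \<noteq> 0" "\<And>y. y \<in> span ((*v) A ` S) \<Longrightarrow> orthogonal v y"
      using orthogonal_to_subspace_exists by blast
    have vS: "v \<bullet> (A *v s) = 0" if "s \<in> S" for s
      using v(2)[of "A *v s"] that by (auto simp: orthogonal_def span_base)
    define r where "r = sqrt (v \<bullet> (A *v v))"
    have r: "r > 0" "r * r = v \<bullet> (A *v v)" using pos[OF v(1)] by (auto simp: r_def)
    define w where "w = v /\<^sub>R r"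
    have wS: "w \<bullet> (A *v s) = 0" "s \<bullet> (A *v w) = 0" if "s \<in> S" for s
      using vS[OF that] symmetric_inner_commute[OF sym, of s w] by (auto simp: w_def)
    have ww: "w \<bullet> (A *v w) = 1" using r by (simp add: w_def matrix_vector_mult_scaleR r(2)[symmetric] field_simps)
    have "w \<notin> S" using wS ww by force
    moreover have "Q (insert w S)" using S wS ww \<open>w \<notin> S\<close> by (auto simp: Q_def)
    ultimately show False using max[of "insert w S"] fS by simp
  qed
  then obtain f where f: "bij_betw f (UNIV :: 'p set) S"
    using finite_same_card_bij[of "UNIV :: 'p set" S] fS by auto
  define B where "B = (\<chi> i j. f j $ i)"
  have col: "column j B = f j" for j by (simp add: B_def column_def vec_eq_iff)
  have "(transpose B ** A ** B) $ i $ j = f i \<bullet> (A *v f j)" for i j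
  proof -
    have "(transpose B ** A ** B) $ i $ j = (\<Sum>k\<in>UNIV. (\<Sum>l\<in>UNIV. f i $ l * A $ l $ k) * f j $ k)"
      by (simp add: matrix_matrix_mult_def B_def transpose_def)
    also have "\<dots> = f i \<bullet> (A *v f j)"
      by (simp add: inner_vec_def matrix_vector_mult_def sum_distrib_left sum_distrib_right mult.assoc)
        (rule sum.swap)
    finally show ?thesis .
  qed
  also have "f i \<bullet> (A *v f j) = (if i = j then 1 else 0)" for i j
    using S f by (auto simp: Q_def bij_betw_def inj_on_def)
  finally have "transpose B ** A ** B = mat 1" by (simp add: vec_eq_iff mat_def)
  then show thesis by (rule that)
qed

section \<open>Gaussian integrals and relabelling of coordinates\<close>

lemma gaussian_integral_standard:
  "has_bochner_integral lborel (\<lambda>x::'a::euclidean_space. exp (- (x \<bullet> x) / 2)) (sqrt (2 * pi) ^ DIM('a))"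
proof (rule has_bochner_integral_nn_integral)
  have 1: "(\<integral>\<^sup>+x. ennreal (exp (- x\<^sup>2 / 2)) \<partial>lborel) = ennreal (sqrt (2 * pi))"
  proof -
    have "(\<integral>\<^sup>+x. ennreal (std_normal_density x) \<partial>lborel) = ennreal 1"
      by (subst nn_integral_eq_integral) (auto simp: integral_normal_density)
    moreover have "ennreal (exp (- x\<^sup>2 / 2)) = ennreal (sqrt (2 * pi)) * ennreal (std_normal_density x)" for x
      by (subst ennreal_mult[symmetric]) (auto simp: std_normal_density_def)
    ultimately show ?thesis by (simp add: nn_integral_cmult)
  qed
  have "(\<integral>\<^sup>+(x::'a). ennreal (exp (- (x \<bullet> x) / 2)) \<partial>lborel)
      = (\<integral>\<^sup>+(x::'a). (\<Prod>b\<in>Basis. ennreal (exp (- (x \<bullet> b)\<^sup>2 / 2))) \<partial>lborel)"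
  proof (rule nn_integral_cong)
    fix x :: 'a
    have "- (x \<bullet> x) / 2 = (\<Sum>b\<in>Basis. - (x \<bullet> b)\<^sup>2 / 2)"
      by (subst euclidean_inner) (simp add: sum_negf sum_divide_distrib power2_eq_square)
    then show "ennreal (exp (- (x \<bullet> x) / 2)) = (\<Prod>b\<in>Basis. ennreal (exp (- (x \<bullet> b)\<^sup>2 / 2)))"
      by (simp add: exp_sum prod_ennreal)
  qed
  also have "\<dots> = (\<Prod>b\<in>(Basis::'a set). \<integral>\<^sup>+x. ennreal (exp (- x\<^sup>2 / 2)) \<partial>lborel)"
    by (rule nn_integral_lborel_prod) auto
  also have "\<dots> = ennreal (sqrt (2 * pi) ^ DIM('a))" by (subst 1) (simp add: ennreal_power)
  finally show "(\<integral>\<^sup>+(x::'a). ennreal (exp (- (x \<bullet> x) / 2)) \<partial>lborel) = ennreal (sqrt (2 * pi) ^ DIM('a))" .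
qed auto

text \<open>The linear change of variables in the library requires a well-ordered index type; a copy of
  \<open>{..<CARD('a)}\<close> provides one for an arbitrary finite type.\<close>

typedef ('a::finite) index = "{..<CARD('a)}"
  by (intro exI[of _ 0]) auto

instantiation index :: (finite) linorder
begin

definition less_eq_index :: "'a index \<Rightarrow> 'a index \<Rightarrow> bool" where
  "x \<le> y \<longleftrightarrow> Rep_index x \<le> Rep_index y"

definition less_index :: "'a index \<Rightarrow> 'a index \<Rightarrow> bool" where
  "x < y \<longleftrightarrow> Rep_index x < Rep_index y"

instance
  by standard (auto simp: less_eq_index_def less_index_def Rep_index_inject)

end

instance index :: (finite) finite
proof
  have "(UNIV :: 'a index set) = Abs_index ` {..<CARD('a)}"
    using type_definition.Abs_image[OF type_definition_index] by auto
  then show "finite (UNIV :: 'a index set)" by (metis finite_imageI finite_lessThan)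
qed

instance index :: (finite) wellorder
proof
  fix P :: "'a index \<Rightarrow> bool" and a
  assume *: "\<And>x. (\<And>y. y < x \<Longrightarrow> P y) \<Longrightarrow> P x"
  show "P a"
    by (induction a rule: measure_induct_rule[of Rep_index]) (use * in \<open>auto simp: less_index_def\<close>)
qed

lemma card_index: "CARD('a index) = CARD('a::finite)"
  by (simp add: type_definition.card[OF type_definition_index])

definition reindex_vec :: "('q \<Rightarrow> 'p) \<Rightarrow> 'a ^ 'p \<Rightarrow> 'a ^ 'q" where
  "reindex_vec e x = (\<chi> i. x $ e i)"

lemma reindex_vec_nth [simp]: "reindex_vec e x $ i = x $ e i"
  by (simp add: reindex_vec_def)

text \<open>Conjugation by \<open>e\<close> matches the permutations of the two index types and
  preserves signs, so the two Leibniz sums agree term by term.\<close>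

lemma det_reindex:
  fixes A :: "'a::comm_ring_1 ^ 'p ^ 'p"
  assumes e: "bij (e :: 'q::finite \<Rightarrow> 'p)"
  shows "det (\<chi> i j. A $ e i $ e j) = det A"
proof -
  have bij: "bij_betw e UNIV UNIV" and inj: "inj e" using e by (auto simp: bij_def bij_betw_def)
  have inv: "bij_betw (inv e) UNIV UNIV" using bij_imp_bij_inv[OF e] by simp
  let ?m = "map_permutation UNIV e" and ?m' = "map_permutation UNIV (inv e)"
  have "det A = (\<Sum>p | p permutes (UNIV::'p set). of_int (sign p) * (\<Prod>i\<in>UNIV. A $ i $ p i))"
    by (simp add: det_def)
  also have "\<dots> = (\<Sum>p | p permutes (UNIV::'q set). of_int (sign p) * (\<Prod>i\<in>UNIV. A $ e i $ e (p i)))"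
  proof (rule sum.reindex_bij_witness[of _ ?m ?m'])
    fix p assume "p \<in> {p. p permutes (UNIV :: 'p set)}"
    then have p: "p permutes (UNIV :: 'p set)" by simp
    show "?m (?m' p) = p"
      by (rule map_permutation_compose_inv[OF inv p]) (simp add: bij_is_surj[OF e] surj_f_inv_f)
    show "?m' p \<in> {p. p permutes (UNIV :: 'q set)}"
      using map_permutation_permutes[OF inv p] by simp
    have s: "sign (?m' p) = sign p"
      by (rule sign_map_permutation) (use inv p in \<open>auto simp: bij_betw_def\<close>)
    have ap: "e (?m' p i) = p (e i)" for i
      using map_permutation_apply[of "inv e" UNIV "e i" p] inv inj e
      by (simp add: bij_betw_def bij_is_surj surj_f_inv_f)
    have "(\<Prod>i\<in>UNIV. A $ e i $ p (e i)) = (\<Prod>i\<in>UNIV. A $ i $ p i)"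
      by (rule prod.reindex_bij_betw[OF bij])
    then show "of_int (sign (?m' p)) * (\<Prod>i\<in>UNIV. A $ e i $ e (?m' p i))
        = of_int (sign p) * (\<Prod>i\<in>UNIV. A $ i $ p i)"
      by (simp add: s ap)
  next
    fix p assume "p \<in> {p. p permutes (UNIV :: 'q set)}"
    then have p: "p permutes (UNIV :: 'q set)" by simp
    show "?m' (?m p) = p"
      by (rule map_permutation_compose_inv[OF bij p]) (simp add: inj)
    show "?m p \<in> {p. p permutes (UNIV :: 'p set)}"
      using map_permutation_permutes[OF bij p] by simp
  qed
  finally show ?thesis by (simp add: det_def)
qed

lemma prod_Basis_cart: "(\<Prod>b\<in>Basis. (x :: real ^ 'p) \<bullet> b) = (\<Prod>i\<in>UNIV. x $ i)"
proof -
  have "(\<Prod>b\<in>Basis. x \<bullet> b) = (\<Prod>b\<in>(\<lambda>i. axis i (1::real)) ` UNIV. x \<bullet> b)"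
    by (rule prod.cong) (auto simp: Basis_vec_def)
  also have "\<dots> = (\<Prod>i\<in>UNIV. x $ i)"
    by (subst prod.reindex) (auto simp: inj_on_def axis_eq_axis cart_eq_inner_axis)
  finally show ?thesis .
qed

lemma measurable_reindex_vec [measurable]:
  "(reindex_vec e :: real ^ 'p \<Rightarrow> real ^ 'q) \<in> borel_measurable borel"
  unfolding reindex_vec_def
  by (intro borel_measurable_continuous_onI continuous_on_vec_lambda continuous_intros)

text \<open>Lebesgue measure is determined by its values on boxes, and the preimage of a box is a
  box with the same side lengths in another order.\<close>

lemma distr_lborel_reindex_vec:
  assumes e: "bij (e :: 'p::finite \<Rightarrow> 'q::finite)"
  shows "distr lborel borel (reindex_vec e) = (lborel :: (real ^ 'p) measure)"
proof (rule lborel_eqI[symmetric])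
  fix l u :: "real ^ 'p" assume le: "\<And>b. b \<in> Basis \<Longrightarrow> l \<bullet> b \<le> u \<bullet> b"
  let ?r = "reindex_vec (inv e) :: real ^ 'p \<Rightarrow> real ^ 'q"
  have "reindex_vec e -` box l u = box (?r l) (?r u)"
  proof (intro set_eqI iffI)
    fix x assume "x \<in> reindex_vec e -` box l u"
    then have *: "l $ i < x $ e i" "x $ e i < u $ i" for i by (auto simp: mem_box_cart)
    show "x \<in> box (?r l) (?r u)"
      unfolding mem_box_cart using *[of "inv e _"] by (simp add: bij_is_surj[OF e] surj_f_inv_f)
  next
    fix x assume "x \<in> box (?r l) (?r u)"
    then have *: "l $ inv e i < x $ i" "x $ i < u $ inv e i" for i by (auto simp: mem_box_cart)
    show "x \<in> reindex_vec e -` box l u"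
      using *[of "e _"] by (auto simp: mem_box_cart bij_is_inj[OF e])
  qed
  moreover have "?r l \<bullet> b \<le> ?r u \<bullet> b" if "b \<in> Basis" for b
    using that le[OF axis_in_Basis_iff[THEN iffD2, of 1]] by (auto simp: Basis_vec_def cart_eq_inner_axis[symmetric])
  moreover have "(\<Prod>i\<in>UNIV. ?r (u - l) $ i) = (\<Prod>i\<in>UNIV. (u - l) $ i)"
    unfolding reindex_vec_nth by (rule prod.reindex_bij_betw) (simp add: bij_imp_bij_inv[OF e])
  moreover have "?r u - ?r l = ?r (u - l)" by (simp add: vec_eq_iff)
  ultimately show "emeasure (distr lborel borel (reindex_vec e)) (box l u) = (\<Prod>b\<in>Basis. (u - l) \<bullet> b)"
    by (simp add: emeasure_distr emeasure_lborel_box_eq prod_Basis_cart)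
qed simp

text \<open>Substitution x = By with A-orthonormal columns: the form becomes |y|^2, and the Jacobian
  |det B| equals 1/sqrt(det A).\<close>

lemma gaussian_integral_wellorder:
  fixes A :: "real ^ 'p::{finite,wellorder} ^ 'p::{finite,wellorder}"
  assumes sym: "transpose A = A" and pos: "\<And>v. v \<noteq> 0 \<Longrightarrow> 0 < v \<bullet> (A *v v)"
  shows "0 < det A"
    and "has_bochner_integral lborel (\<lambda>x. exp (- (x \<bullet> (A *v x)) / 2)) (sqrt (2 * pi) ^ CARD('p) / sqrt (det A))"
proof -
  obtain B :: "real ^ 'p::{finite,wellorder} ^ 'p::{finite,wellorder}" where B: "transpose B ** A ** B = mat 1"
    using ex_orthonormal_basis_matrix[OF assms] by blast
  from arg_cong[OF this, of det] have d: "det A * (det B)\<^sup>2 = 1"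
    by (simp add: det_mul det_transpose power2_eq_square mult_ac)
  then have dB: "det B \<noteq> 0" by auto
  then have "(det B)\<^sup>2 > 0" by simp
  with d show dA: "0 < det A" by (metis zero_less_mult_pos2 zero_less_one)
  have "\<bar>det B\<bar> * sqrt (det A) = 1"
    using arg_cong[OF d, of sqrt] by (simp add: real_sqrt_mult mult.commute)
  with dA have abs: "\<bar>det B\<bar> = 1 / sqrt (det A)" by (simp add: field_simps)
  let ?f = "\<lambda>x. exp (- (x \<bullet> (A *v x)) / 2)" and ?g = "\<lambda>x::real^'p::{finite,wellorder}. exp (- (x \<bullet> x) / 2)"
  let ?c = "sqrt (2 * pi) ^ CARD('p)"
  have AB: "(B *v x) \<bullet> (A *v (B *v x)) = x \<bullet> x" for x
    using B by (metis dot_lmul_matrix inner_commute matrix_vector_mul_assoc matrix_vector_mul_lid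
        transpose_matrix_vector)
  have g: "has_bochner_integral lborel ?g ?c"
    using gaussian_integral_standard[where 'a="real^'p::{finite,wellorder}"] by simp
  have ai: "?g absolutely_integrable_on UNIV" and ig: "integral UNIV ?g = ?c"
    using g by (auto simp: has_bochner_integral_iff set_integrable_def integrable_completion integral_lborel)
  have lin: "linear ((*v) B)" by simp
  have "bij ((*v) B)" using dB invertible_det_nz[of B] by (metis invertible_eq_bij)
  then have img: "(*v) B ` UNIV = UNIV" by (simp add: bij_def)
  have "(\<lambda>x. \<bar>det B\<bar> * ?g x) absolutely_integrable_on UNIV \<and> integral UNIV (\<lambda>x. \<bar>det B\<bar> * ?g x) = \<bar>det B\<bar> * ?c"
    using ai ig by simp
  \<comment> \<open>The rule for linear substitutions speaks of vector-valued integrands, hence the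
    passage through \<open>real^1\<close>.\<close>
  then have f: "?f absolutely_integrable_on UNIV \<and> integral UNIV ?f = \<bar>det B\<bar> * ?c"
    using has_absolute_integral_change_of_variables_linear[OF lin, of UNIV "\<lambda>x. vec (?f x) :: real^1" "vec (\<bar>det B\<bar> * ?c)"]
    by (simp add: absolutely_integrable_on_1_iff integral_on_1_eq img AB vec_eq_iff)
  have "?f \<in> borel_measurable lborel" by simp
  with f have "integrable lborel ?f" using integrable_completion[of ?f lborel] by (simp add: set_integrable_def)
  with f show "has_bochner_integral lborel ?f (?c / sqrt (det A))"
    by (simp add: has_bochner_integral_iff integral_lborel abs)
qed

text \<open>Relabelling the coordinates preserves Lebesgue measure, the quadratic form and the
  determinant, which reduces an arbitrary index type to a well-ordered one.\<close>

lemma gaussian_integral: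
  fixes A :: "real ^ 'p ^ 'p"
  assumes sym: "transpose A = A" and pos: "\<And>v. v \<noteq> 0 \<Longrightarrow> 0 < v \<bullet> (A *v v)"
  shows "0 < det A"
    and "has_bochner_integral lborel (\<lambda>x. exp (- (x \<bullet> (A *v x)) / 2)) (sqrt (2 * pi) ^ CARD('p) / sqrt (det A))"
proof -
  obtain e :: "'p index \<Rightarrow> 'p" where e: "bij e"
    using finite_same_card_bij[of "UNIV :: 'p index set" "UNIV :: 'p set"] card_index[where 'a='p]
    by auto
  then have bij: "bij_betw e UNIV UNIV" by (auto simp: bij_def bij_betw_def)
  define A' :: "real ^ 'p index ^ 'p index" where "A' = (\<chi> i j. A $ e i $ e j)"
  have det: "det A' = det A" unfolding A'_def by (rule det_reindex[OF e])
  let ?r = "reindex_vec e :: real ^ 'p \<Rightarrow> real ^ 'p index"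
  have q: "?r x \<bullet> (A' *v ?r x) = x \<bullet> (A *v x)" for x
    by (simp add: inner_vec_def matrix_vector_mult_def A'_def
        sum.reindex_bij_betw[OF bij, of "\<lambda>j. A $ _ $ j * x $ j"]
        sum.reindex_bij_betw[OF bij, of "\<lambda>i. x $ i * (\<Sum>j\<in>UNIV. A $ i $ j * x $ j)"])
  have sym': "transpose A' = A'"
    using sym by (simp add: vec_eq_iff transpose_def A'_def)
  have pos': "0 < v \<bullet> (A' *v v)" if "v \<noteq> 0" for v
  proof -
    have v: "v = ?r (reindex_vec (inv e) v)" by (simp add: vec_eq_iff bij_is_inj[OF e])
    from that obtain i where "v $ i \<noteq> 0" by (auto simp: vec_eq_iff)
    then have "reindex_vec (inv e) v $ e i \<noteq> 0" by (simp add: bij_is_inj[OF e])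
    then have "reindex_vec (inv e) v \<noteq> 0" by (metis zero_index)
    then show ?thesis by (subst (1 2) v) (simp add: q pos)
  qed
  show "0 < det A" using gaussian_integral_wellorder(1)[OF sym' pos'] det by simp
  have "has_bochner_integral (distr lborel borel ?r) (\<lambda>x. exp (- (x \<bullet> (A' *v x)) / 2))
      (sqrt (2 * pi) ^ CARD('p) / sqrt (det A))"
    using gaussian_integral_wellorder(2)[OF sym' pos'] det e card_index[where 'a='p]
    by (simp add: distr_lborel_reindex_vec)
  moreover have "(\<lambda>x. exp (- (x \<bullet> (A' *v x)) / 2)) \<in> borel_measurable borel" by measurable
  ultimately show "has_bochner_integral lborel (\<lambda>x. exp (- (x \<bullet> (A *v x)) / 2))
      (sqrt (2 * pi) ^ CARD('p) / sqrt (det A))"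
    by (simp add: has_bochner_integral_iff integrable_distr_eq integral_distr q)
qed

section \<open>Analytic estimates\<close>

text \<open>Dominated convergence in quantitative form. The radius and the tolerance are fixed by
  the majorant and \<epsilon> before the two functions are chosen, so the bound is uniform over all
  outcomes when the functions are random.\<close>

lemma integral_diff_small_of_close_on_ball:
  fixes g :: "'a::euclidean_space \<Rightarrow> real"
  assumes g: "integrable lborel g" and eps: "0 < \<epsilon>"
  obtains m \<delta> where "0 < m" "0 < \<delta>"
    "\<And>w v. w \<in> borel_measurable borel \<Longrightarrow> v \<in> borel_measurable borel \<Longrightarrow>
      (\<And>u. \<bar>w u\<bar> \<le> g u) \<Longrightarrow> (\<And>u. \<bar>v u\<bar> \<le> g u) \<Longrightarrow>
      (\<And>u. norm u \<le> m \<Longrightarrow> \<bar>w u - v u\<bar> \<le> \<delta>) \<Longrightarrow>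
      \<bar>(\<integral>u. w u \<partial>lborel) - (\<integral>u. v u \<partial>lborel)\<bar> \<le> \<epsilon>"
proof -
  have [measurable]: "g \<in> borel_measurable borel" using g by auto
  let ?t = "\<lambda>n::nat. \<integral>u. indicator {u. real n < norm u} u * g u \<partial>lborel"
  have "?t \<longlonglongrightarrow> (\<integral>u. 0 \<partial>(lborel::'a measure))"
  proof (rule integral_dominated_convergence[where w="\<lambda>u. \<bar>g u\<bar>"])
    show "AE u in lborel. (\<lambda>n. indicator {u. real n < norm u} u * g u) \<longlonglongrightarrow> 0"
    proof (rule AE_I2)
      fix u :: 'a
      have "eventually (\<lambda>n. indicator {u. real n < norm u} u * g u = 0) sequentially"
        using eventually_ge_at_top[of "nat \<lceil>norm u\<rceil>"]
      proof eventually_elim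
        case (elim n)
        then have "\<not> real n < norm u" by linarith
        then show ?case by simp
      qed
      then show "(\<lambda>n. indicator {u. real n < norm u} u * g u) \<longlonglongrightarrow> 0"
        by (simp add: tendsto_eventually)
    qed
  qed (use g in \<open>auto simp: indicator_def\<close>)
  then have "eventually (\<lambda>n. ?t n < \<epsilon> / 4) sequentially"
    using eps by (intro order_tendstoD(2)[of _ 0]) auto
  then obtain N where N: "\<And>n. n \<ge> N \<Longrightarrow> ?t n < \<epsilon> / 4" by (auto simp: eventually_sequentially)
  define m where "m = Suc N"
  have m: "?t m < \<epsilon> / 4" using N[of m] by (simp add: m_def)
  define V where "V = measure lborel (cball (0::'a) m)"
  have V: "V \<ge> 0" by (simp add: V_def)
  \<comment> \<open>The ball of volume V contributes at most \<delta> V \<le> \<epsilon>/2. Outside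
    it the difference is at most 2g, and the tail of g is below \<epsilon>/4. The summand 1 keeps
    the denominator positive from V \<ge> 0 alone.\<close>
  define \<delta> where "\<delta> = \<epsilon> / (2 * (V + 1))"
  have \<delta>: "\<delta> > 0" using eps V by (simp add: \<delta>_def)
  show thesis
  proof (rule that[of "real m" \<delta>])
    show "0 < real m" by (simp add: m_def)
    show "0 < \<delta>" by fact
    fix w v :: "'a \<Rightarrow> real"
    assume [measurable]: "w \<in> borel_measurable borel" "v \<in> borel_measurable borel"
      and w: "\<And>u. \<bar>w u\<bar> \<le> g u" and v: "\<And>u. \<bar>v u\<bar> \<le> g u"
      and wv: "\<And>u. norm u \<le> real m \<Longrightarrow> \<bar>w u - v u\<bar> \<le> \<delta>"
    have g0: "g u \<ge> 0" for u using w[of u] by linarith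
    have iw: "integrable lborel w"
      by (rule Bochner_Integration.integrable_bound[OF g]) (use w g0 in auto)
    have iv: "integrable lborel v"
      by (rule Bochner_Integration.integrable_bound[OF g]) (use v g0 in auto)
    have it: "integrable lborel (\<lambda>u. indicator {u. real m < norm u} u * g u)"
      by (rule Bochner_Integration.integrable_bound[OF g]) (auto simp: indicator_def)
    have ib: "integrable lborel (indicator (cball (0::'a) m) :: 'a \<Rightarrow> real)"
      by (intro integrable_real_indicator emeasure_bounded_finite) auto
    have "\<bar>(\<integral>u. w u \<partial>lborel) - (\<integral>u. v u \<partial>lborel)\<bar> = \<bar>\<integral>u. w u - v u \<partial>lborel\<bar>"
      using iw iv by simp
    also have "\<dots> \<le> (\<integral>u. \<bar>w u - v u\<bar> \<partial>lborel)"
      using integral_norm_bound[of lborel "\<lambda>u. w u - v u"] by simp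
    also have "\<dots> \<le> (\<integral>u. \<delta> * indicator (cball 0 m) u + 2 * (indicator {u. real m < norm u} u * g u) \<partial>lborel)"
    proof (rule integral_mono)
      fix u
      show "\<bar>w u - v u\<bar> \<le> \<delta> * indicator (cball 0 m) u + 2 * (indicator {u. real m < norm u} u * g u)"
        using wv[of u] w[of u] v[of u] by (auto simp: indicator_def)
    qed (use iw iv it ib in auto)
    also have "\<dots> = \<delta> * V + 2 * ?t m"
      using it ib by (simp add: V_def)
    also have "\<delta> * V \<le> \<epsilon> / 2" using V eps by (simp add: \<delta>_def field_simps)
    finally show "\<bar>(\<integral>u. w u \<partial>lborel) - (\<integral>u. v u \<partial>lborel)\<bar> \<le> \<epsilon>" using m by linarith
  qed
qed

text \<open>The Gaussian integral for a multiple of the identity. A lower bound on the information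
  leads to such a function as integrable majorant, an upper bound to its integral as a positive
  minorant.\<close>

lemma isotropic_gaussian_integral:
  assumes "0 < l"
  shows "integrable lborel (\<lambda>u :: real ^ 'p. exp (- (l * (u \<bullet> u)) / 2))"
    and "0 < (\<integral>(u :: real ^ 'p). exp (- (l * (u \<bullet> u)) / 2) \<partial>lborel)"
proof -
  let ?A = "l *\<^sub>R mat 1 :: real ^ 'p ^ 'p"
  have A: "?A *v v = l *\<^sub>R v" for v
    by (simp add: scaleR_matrix_vector_assoc[symmetric])
  have sym: "transpose ?A = ?A" by (simp add: vec_eq_iff transpose_def mat_def)
  have pos: "0 < v \<bullet> (?A *v v)" if "v \<noteq> 0" for v using that assms by (simp add: A)
  note G = gaussian_integral[OF sym pos, unfolded A inner_scaleR_right]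
  show "integrable lborel (\<lambda>u :: real ^ 'p. exp (- (l * (u \<bullet> u)) / 2))"
    using G(2) by (auto simp: has_bochner_integral_iff)
  show "0 < (\<integral>(u :: real ^ 'p). exp (- (l * (u \<bullet> u)) / 2) \<partial>lborel)"
    using G by (auto simp: has_bochner_integral_iff)
qed

section \<open>Change of variables, Taylor remainders and logarithms\<close>

lemma lborel_integral_affine:
  fixes f :: "'a::euclidean_space \<Rightarrow> real"
  assumes c: "0 < c" and [measurable]: "f \<in> borel_measurable borel"
  shows "(\<integral>x. f x \<partial>lborel) = c ^ DIM('a) * (\<integral>u. f (t + c *\<^sub>R u) \<partial>lborel)"
proof -
  have "(\<integral>x. f x \<partial>lborel) = (\<integral>x. f x \<partial>density (distr lborel borel (\<lambda>x. t + c *\<^sub>R x)) (\<lambda>_. \<bar>c\<bar>^DIM('a)))"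
    using lborel_affine[of c t] c by simp
  then show ?thesis using c by (simp add: integral_density integral_distr)
qed

text \<open>Lagrange's form of the remainder. The closed segment accommodates both signs of t and
  also t = 0, where the Taylor rule does not apply and \<xi> = s works.\<close>

lemma taylor_second_order:
  fixes f :: "real \<Rightarrow> real"
  assumes f: "\<And>x. (f has_field_derivative f' x) (at x)"
    "\<And>x. (f' has_field_derivative f'' x) (at x)"
  obtains \<xi> where "\<xi> \<in> closed_segment s (s + t)" "f (s + t) = f s + f' s * t + f'' \<xi> * t\<^sup>2 / 2"
proof (cases "t = 0")
  case False
  define df where "df = (\<lambda>m::nat. if m = 0 then f else if m = 1 then f' else f'')"
  have "\<exists>\<xi>. (if s + t < s then s + t < \<xi> \<and> \<xi> < s else s < \<xi> \<and> \<xi> < s + t) \<and>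
      f (s + t) = (\<Sum>m<2. df m s / fact m * (s + t - s) ^ m) + df 2 \<xi> / fact 2 * (s + t - s) ^ 2"
    by (rule Taylor[where a="min s (s + t)" and b="max s (s + t)"])
      (use False f in \<open>auto simp: df_def less_2_cases_iff\<close>)
  then obtain \<xi> where "if s + t < s then s + t < \<xi> \<and> \<xi> < s else s < \<xi> \<and> \<xi> < s + t"
    and "f (s + t) = (\<Sum>m<2. df m s / fact m * (s + t - s) ^ m) + df 2 \<xi> / fact 2 * (s + t - s) ^ 2"
    by blast
  then show thesis
    by (intro that[of \<xi>])
      (auto simp: df_def closed_segment_eq_real_ivl eval_nat_numeral split: if_splits)
qed (use that[of s] in auto)

text \<open>The mean value inequality for \<open>f''\<close> turns the second-order Lagrange form
  into a cubic remainder. The factor 1/2 is dropped, since only the order matters later.\<close>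

lemma taylor_third_order_bound:
  fixes f :: "real \<Rightarrow> real"
  assumes f: "\<And>x. (f has_field_derivative f' x) (at x)"
    "\<And>x. (f' has_field_derivative f'' x) (at x)"
    "\<And>x. (f'' has_field_derivative f''' x) (at x)"
    and bd: "\<And>\<xi>. \<xi> \<in> closed_segment s (s + t) \<Longrightarrow> \<bar>f''' \<xi>\<bar> \<le> B"
  shows "\<bar>f (s + t) - f s - f' s * t - f'' s * t\<^sup>2 / 2\<bar> \<le> B * \<bar>t\<bar> ^ 3"
proof -
  obtain \<xi> where xi: "\<xi> \<in> closed_segment s (s + t)"
    and eq: "f (s + t) = f s + f' s * t + f'' \<xi> * t\<^sup>2 / 2"
    using taylor_second_order[OF f(1,2)] by metis
  have B: "0 \<le> B" using bd[of s] by auto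
  have "norm (f'' \<xi> - f'' s) \<le> B * norm (\<xi> - s)"
  proof (rule field_differentiable_bound[of "closed_segment s (s + t)" f'' f'''])
    show "(f'' has_field_derivative f''' z) (at z within closed_segment s (s + t))" for z
      using f(3) by (rule has_field_derivative_at_within)
  qed (use xi bd in auto)
  also have "\<dots> \<le> B * \<bar>t\<bar>"
    using xi B by (intro mult_left_mono) (auto simp: closed_segment_eq_real_ivl split: if_splits)
  finally have *: "\<bar>f'' \<xi> - f'' s\<bar> \<le> B * \<bar>t\<bar>" by simp
  have "\<bar>f (s + t) - f s - f' s * t - f'' s * t\<^sup>2 / 2\<bar> = \<bar>f'' \<xi> - f'' s\<bar> * t\<^sup>2 / 2"
    by (simp add: eq abs_mult left_diff_distrib[symmetric] diff_divide_distrib[symmetric])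
  also have "\<dots> \<le> \<bar>f'' \<xi> - f'' s\<bar> * t\<^sup>2" by simp
  also have "\<dots> \<le> (B * \<bar>t\<bar>) * t\<^sup>2" using * by (intro mult_right_mono) auto
  also have "\<dots> = B * \<bar>t\<bar> ^ 3" by (simp add: power3_eq_cube power2_eq_square)
  finally show ?thesis .
qed

lemma rpow_mono: "0 \<le> x \<Longrightarrow> x \<le> y \<Longrightarrow> 0 \<le> a \<Longrightarrow> rpow x a \<le> rpow y a"
  by (auto simp: rpow_def intro: powr_mono2)

lemma rpow_nonneg: "0 \<le> rpow x a"
  by (simp add: rpow_def)

lemma transpose_weighted_outer:
  "transpose (a *\<^sub>R (\<Sum>j\<in>J. c j *\<^sub>R outer (x j))) = a *\<^sub>R (\<Sum>j\<in>J. c j *\<^sub>R outer (x j))"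
  by (simp add: vec_eq_iff transpose_def outer_def mult.commute)

lemma outer_mult_vec: "outer x *v v = (x \<bullet> v) *\<^sub>R x"
  by (simp add: vec_eq_iff outer_def matrix_vector_mult_def inner_vec_def sum_distrib_right sum_distrib_left mult_ac)

lemma quadratic_form_weighted_outer:
  fixes x :: "nat \<Rightarrow> real ^ 'p"
  shows "v \<bullet> ((a *\<^sub>R (\<Sum>j\<in>J. c j *\<^sub>R outer (x j))) *v v) = a * (\<Sum>j\<in>J. c j * (x j \<bullet> v)\<^sup>2)"
proof -
  have "(\<Sum>j\<in>J. c j *\<^sub>R outer (x j)) *v v = (\<Sum>j\<in>J. c j *\<^sub>R (outer (x j) *v v))"
    by (induction J rule: infinite_finite_induct)
      (auto simp: matrix_vector_mult_add_rdistrib scaleR_matrix_vector_assoc)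
  then show ?thesis
    by (simp add: scaleR_matrix_vector_assoc[symmetric] outer_mult_vec inner_sum_right
        power2_eq_square inner_commute mult_ac)
qed

text \<open>Factor out the larger exponential and use 1 - exp(-t) \<le> t. An error in a
  log-likelihood decrement thus passes unmagnified to its exponential.\<close>

lemma abs_exp_minus_diff_le:
  fixes x y :: real
  assumes "0 \<le> x" "0 \<le> y"
  shows "\<bar>exp (- x) - exp (- y)\<bar> \<le> \<bar>x - y\<bar>"
proof -
  have *: "exp (- x) - exp (- y) \<le> y - x" if "0 \<le> x" "x \<le> y" for x y :: real
  proof -
    have "exp (- x) - exp (- y) = exp (- x) * (1 - exp (x - y))"
      by (simp add: right_diff_distrib exp_add[symmetric])
    also have "\<dots> \<le> 1 * (1 - exp (x - y))" using that by (intro mult_right_mono) auto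
    also have "1 * (1 - exp (x - y)) = 1 - exp (x - y)" by simp
    also have "\<dots> \<le> y - x" using exp_ge_add_one_self[of "x - y"] by linarith
    finally show ?thesis .
  qed
  show ?thesis
    using *[of x y] *[of y x] assms by (cases "x \<le> y") (auto simp: abs_if)
qed

text \<open>One side is ln x \<le> x - 1; the other applies the same inequality to 1/x, where x
  \<ge> 1/2 yields the factor 2.\<close>

lemma abs_ln_le:
  fixes x :: real
  assumes "\<bar>x - 1\<bar> \<le> 1 / 2"
  shows "\<bar>ln x\<bar> \<le> 2 * \<bar>x - 1\<bar>"
proof -
  have *: "a \<le> 2 * \<bar>a\<bar>" for a :: real by linarith
  have x: "x \<ge> 1 / 2" using assms by linarith
  have "ln x \<le> x - 1" using x by (intro ln_le_minus_one) auto
  moreover have "- ln x \<le> 2 * \<bar>x - 1\<bar>"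
  proof -
    have "- ln x = ln (1 / x)" using x by (simp add: ln_div)
    also have "\<dots> \<le> 1 / x - 1" using x by (intro ln_le_minus_one) auto
    also have "\<dots> = (1 - x) / x" using x by (simp add: diff_divide_distrib)
    also have "\<dots> \<le> \<bar>x - 1\<bar> / (1 / 2)" using x by (intro frac_le) auto
    finally show ?thesis by simp
  qed
  moreover have "x - 1 \<le> 2 * \<bar>x - 1\<bar>" using *[of "x - 1"] .
  ultimately show ?thesis by (simp add: abs_le_iff)
qed

text \<open>Additive errors pass to logarithms only away from 0; the lower bound l on c makes the
  rate independent of c. The proof goes through the ratio a/c.\<close>

lemma abs_ln_diff_le:
  fixes a c :: real
  assumes "0 < l" "l \<le> c" "\<bar>a - c\<bar> \<le> e" "e \<le> l / 2"
  shows "0 < a" "\<bar>ln a - ln c\<bar> \<le> 2 * e / l"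
proof -
  show a: "0 < a" using assms by linarith
  have c: "0 < c" using assms by linarith
  have e: "0 \<le> e" using assms by linarith
  have eq: "a / c - 1 = (a - c) / c" using c by (simp add: field_simps)
  have le: "\<bar>a / c - 1\<bar> \<le> e / l"
    unfolding eq abs_divide using assms c by (intro frac_le) auto
  also have "e / l \<le> 1 / 2" using assms by (simp add: field_simps)
  finally have "\<bar>ln (a / c)\<bar> \<le> 2 * \<bar>a / c - 1\<bar>" by (rule abs_ln_le)
  then show "\<bar>ln a - ln c\<bar> \<le> 2 * e / l" using le a c by (simp add: ln_div)
qed

section \<open>The quasi-likelihood at a fixed sample\<close>

text \<open>No measure occurs here: the estimates hold outcome by outcome, which later makes them
  uniform over the sample space.\<close>

locale quasi_glm =
  fixes \<Theta> :: "(real ^ 'p) set" and b :: "real \<Rightarrow> real" and b_low :: "real ^ 'p \<Rightarrow> real"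
    and C K r :: real and X :: "nat \<Rightarrow> 'w \<Rightarrow> real ^ 'p" and Y :: "nat \<Rightarrow> 'w \<Rightarrow> real"
  assumes open_Theta: "open \<Theta>" and convex_Theta: "convex \<Theta>"
    and radius: "0 \<le> r" "\<And>\<theta>. \<theta> \<in> \<Theta> \<Longrightarrow> norm \<theta> \<le> r"
    and smooth: "continuously_differentiable 3 b"
    and const: "0 \<le> C" "0 < K"
    and growth: "\<And>x. (MAX i\<in>{1,2,3}. \<bar>(deriv ^^ i) b x\<bar>) \<le> K * (1 + rpow \<bar>x\<bar> C)"
    and b_low_le: "\<And>x. b_low x \<le> (INF \<theta>\<in>\<Theta>. (deriv ^^ 2) b (x \<bullet> \<theta>))"
begin

lemma derivs:
  "(b has_field_derivative deriv b x) (at x)"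
  "(deriv b has_field_derivative (deriv ^^ 2) b x) (at x)"
  "((deriv ^^ 2) b has_field_derivative (deriv ^^ 3) b x) (at x)"
proof -
  have *: "((deriv ^^ i) b has_field_derivative (deriv ^^ Suc i) b x) (at x)" if "i < 3" for i
    using smooth that field_differentiable_derivI[of "(deriv ^^ i) b" x]
    by (simp add: continuously_differentiable_def)
  show "(b has_field_derivative deriv b x) (at x)"
    "(deriv b has_field_derivative (deriv ^^ 2) b x) (at x)"
    "((deriv ^^ 2) b has_field_derivative (deriv ^^ 3) b x) (at x)"
    using *[of 0] *[of 1] *[of 2] by (simp_all add: eval_nat_numeral)
qed

text \<open>As \<Theta> lies in the ball of radius r, |x'\<theta>| \<le> r |x|; the growth condition
  then bounds the first three derivatives of b at x'\<theta> uniformly in \<theta>.\<close>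

definition envelope :: "real ^ 'p \<Rightarrow> real" where
  "envelope x = K * (1 + rpow (r * norm x) C)"

lemma envelope_nonneg: "0 \<le> envelope x"
  using const rpow_nonneg[of "r * norm x" C] by (simp add: envelope_def)

lemma abs_deriv_le_envelope:
  assumes "\<theta> \<in> \<Theta>" "i \<in> {1, 2, 3}"
  shows "\<bar>(deriv ^^ i) b (x \<bullet> \<theta>)\<bar> \<le> envelope x"
proof -
  have "\<bar>(deriv ^^ i) b (x \<bullet> \<theta>)\<bar> \<le> (MAX i\<in>{1,2,3}. \<bar>(deriv ^^ i) b (x \<bullet> \<theta>)\<bar>)"
    by (rule Max_ge) (use assms in auto)
  also have "\<dots> \<le> K * (1 + rpow \<bar>x \<bullet> \<theta>\<bar> C)" by (rule growth)
  also have "\<bar>x \<bullet> \<theta>\<bar> \<le> r * norm x"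
  proof -
    have "\<bar>x \<bullet> \<theta>\<bar> \<le> norm x * norm \<theta>" by (rule Cauchy_Schwarz_ineq2)
    also have "\<dots> \<le> norm x * r" using assms radius by (intro mult_left_mono) auto
    finally show ?thesis by (simp add: mult.commute)
  qed
  then have "K * (1 + rpow \<bar>x \<bullet> \<theta>\<bar> C) \<le> envelope x"
    unfolding envelope_def using const by (intro mult_left_mono add_left_mono rpow_mono) auto
  finally show ?thesis .
qed

lemma b_low_le_deriv2:
  assumes "\<theta> \<in> \<Theta>" shows "b_low x \<le> (deriv ^^ 2) b (x \<bullet> \<theta>)"
proof -
  \<comment> \<open>A real infimum is a lower bound of its family only if the family is bounded
    below; the envelope supplies such a bound.\<close>
  have "bdd_below ((\<lambda>\<theta>. (deriv ^^ 2) b (x \<bullet> \<theta>)) ` \<Theta>)"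
    using abs_deriv_le_envelope[of _ 2 x]
    by (intro bdd_belowI2[of _ "- envelope x"]) (force simp: abs_le_iff minus_le_iff)
  then have "(INF \<theta>\<in>\<Theta>. (deriv ^^ 2) b (x \<bullet> \<theta>)) \<le> (deriv ^^ 2) b (x \<bullet> \<theta>)"
    using assms by (rule cINF_lower)
  with b_low_le[of x] show ?thesis by linarith
qed

text \<open>Convexity of \<Theta> enters here: the intermediate point of a scalar Taylor expansion
  has the form x'\<theta>' with \<theta>' in \<Theta>, so the bounds on derivatives over \<Theta>
  apply to it.\<close>

lemma segment_preimage:
  assumes "\<theta> \<in> \<Theta>" "\<theta> + v \<in> \<Theta>" "\<xi> \<in> closed_segment (x \<bullet> \<theta>) (x \<bullet> \<theta> + x \<bullet> v)"
  obtains \<theta>' where "\<theta>' \<in> \<Theta>" "\<xi> = x \<bullet> \<theta>'"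
proof -
  have "closed_segment (x \<bullet> \<theta>) (x \<bullet> (\<theta> + v)) = (\<lambda>t. x \<bullet> t) ` closed_segment \<theta> (\<theta> + v)"
    by (rule closed_segment_linear_image) (simp add: linear_iff inner_add_right)
  then obtain \<theta>' where "\<theta>' \<in> closed_segment \<theta> (\<theta> + v)" "\<xi> = x \<bullet> \<theta>'"
    using assms(3) by (auto simp: inner_add_right)
  moreover have "closed_segment \<theta> (\<theta> + v) \<subseteq> \<Theta>"
    using assms convex_Theta by (intro closed_segment_subset) auto
  ultimately show thesis using that by blast
qed

definition bregman :: "real ^ 'p \<Rightarrow> real ^ 'p \<Rightarrow> real ^ 'p \<Rightarrow> real" where
  "bregman x \<theta> v = b (x \<bullet> \<theta> + x \<bullet> v) - b (x \<bullet> \<theta>) - deriv b (x \<bullet> \<theta>) * (x \<bullet> v)"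

lemma bregman_ge:
  assumes "\<theta> \<in> \<Theta>" "\<theta> + v \<in> \<Theta>"
  shows "b_low x * (x \<bullet> v)\<^sup>2 / 2 \<le> bregman x \<theta> v"
proof -
  obtain \<xi> where xi: "\<xi> \<in> closed_segment (x \<bullet> \<theta>) (x \<bullet> \<theta> + x \<bullet> v)"
    and eq: "b (x \<bullet> \<theta> + x \<bullet> v) = b (x \<bullet> \<theta>) + deriv b (x \<bullet> \<theta>) * (x \<bullet> v) + (deriv ^^ 2) b \<xi> * (x \<bullet> v)\<^sup>2 / 2"
    by (rule taylor_second_order[OF derivs(1,2), of "x \<bullet> \<theta>" "x \<bullet> v"])
  obtain \<theta>' where "\<theta>' \<in> \<Theta>" "\<xi> = x \<bullet> \<theta>'" using segment_preimage[OF assms xi] by blast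
  then have "b_low x * (x \<bullet> v)\<^sup>2 \<le> (deriv ^^ 2) b \<xi> * (x \<bullet> v)\<^sup>2"
    using b_low_le_deriv2 by (intro mult_right_mono) auto
  then show ?thesis by (simp add: bregman_def eq)
qed

lemma bregman_quadratic_approx:
  assumes "\<theta> \<in> \<Theta>" "\<theta> + v \<in> \<Theta>"
  shows "\<bar>bregman x \<theta> v - (deriv ^^ 2) b (x \<bullet> \<theta>) * (x \<bullet> v)\<^sup>2 / 2\<bar> \<le> envelope x * norm x ^ 3 * norm v ^ 3"
proof -
  have "\<bar>(deriv ^^ 3) b \<xi>\<bar> \<le> envelope x" if "\<xi> \<in> closed_segment (x \<bullet> \<theta>) (x \<bullet> \<theta> + x \<bullet> v)" for \<xi>
    using segment_preimage[OF assms that] abs_deriv_le_envelope[of _ 3 x] by auto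
  from taylor_third_order_bound[OF derivs this]
  have "\<bar>bregman x \<theta> v - (deriv ^^ 2) b (x \<bullet> \<theta>) * (x \<bullet> v)\<^sup>2 / 2\<bar> \<le> envelope x * \<bar>x \<bullet> v\<bar> ^ 3"
    by (simp add: bregman_def)
  also have "\<dots> \<le> envelope x * (norm x * norm v) ^ 3"
    by (intro mult_left_mono power_mono Cauchy_Schwarz_ineq2 envelope_nonneg) auto
  finally show ?thesis by (simp add: power_mult_distrib mult.assoc)
qed

definition score :: "nat \<Rightarrow> 'w \<Rightarrow> real ^ 'p \<Rightarrow> real ^ 'p" where
  "score n \<omega> \<theta> = (\<Sum>j=1..n. (Y j \<omega> - deriv b (X j \<omega> \<bullet> \<theta>)) *\<^sub>R X j \<omega>)"

abbreviation "H n \<omega> \<equiv> quasi_loglik b X Y n \<omega>"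

text \<open>The identity is exact. The response enters the log-likelihood linearly in \<theta>, so
  everything beyond first order is free of Y and consists of Bregman distances of b.\<close>

lemma loglik_expansion:
  "H n \<omega> (\<theta> + v) = H n \<omega> \<theta> + score n \<omega> \<theta> \<bullet> v - (\<Sum>j=1..n. bregman (X j \<omega>) \<theta> v)"
proof -
  have "H n \<omega> (\<theta> + v) = (\<Sum>j=1..n. (Y j \<omega> * (X j \<omega> \<bullet> \<theta>) - b (X j \<omega> \<bullet> \<theta>))
      + (Y j \<omega> - deriv b (X j \<omega> \<bullet> \<theta>)) * (X j \<omega> \<bullet> v) - bregman (X j \<omega>) \<theta> v)"
    unfolding quasi_loglik_def
    by (intro sum.cong refl) (simp only: bregman_def inner_add_right, simp add: ring_distribs)
  then show ?thesis
    by (simp only: quasi_loglik_def score_def sum.distrib sum_subtractf inner_sum_left inner_scaleR_left)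
qed

lemma continuous_on_loglik: "continuous_on S (H n \<omega>)"
proof -
  have "continuous_on UNIV b" by (rule DERIV_continuous_on) (rule has_field_derivative_at_within[OF derivs(1)])
  then have "continuous_on S (\<lambda>\<theta>. b (X j \<omega> \<bullet> \<theta>))" for j
    by (rule continuous_on_compose2) (auto intro: continuous_intros)
  then show ?thesis unfolding quasi_loglik_def by (intro continuous_intros)
qed

lemma score_eq_0:
  assumes "\<theta> \<in> \<Theta>" "\<And>\<theta>'. \<theta>' \<in> \<Theta> \<Longrightarrow> H n \<omega> \<theta>' \<le> H n \<omega> \<theta>"
  shows "score n \<omega> \<theta> = 0"
proof -
  have "(H n \<omega> has_derivative (\<lambda>v. score n \<omega> \<theta> \<bullet> v)) (at \<theta>)"
  proof -
    have b: "((\<lambda>\<theta>. b (X j \<omega> \<bullet> \<theta>)) has_derivative (\<lambda>v. deriv b (X j \<omega> \<bullet> \<theta>) * (X j \<omega> \<bullet> v))) (at \<theta>)" for j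
    proof -
      have "((\<lambda>\<theta>. X j \<omega> \<bullet> \<theta>) has_derivative (\<lambda>v. X j \<omega> \<bullet> v)) (at \<theta>)"
        by (intro bounded_linear_imp_has_derivative bounded_linear_inner_right)
      from has_derivative_compose[OF this derivs(1)[unfolded has_field_derivative_def]]
      show ?thesis .
    qed
    have Yj: "((\<lambda>\<theta>. Y j \<omega> * (X j \<omega> \<bullet> \<theta>)) has_derivative (\<lambda>v. Y j \<omega> * (X j \<omega> \<bullet> v))) (at \<theta>)" for j
      by (intro bounded_linear_imp_has_derivative bounded_linear_const_mult bounded_linear_inner_right)
    have "(\<lambda>v. score n \<omega> \<theta> \<bullet> v)
        = (\<lambda>v. \<Sum>j=1..n. Y j \<omega> * (X j \<omega> \<bullet> v) - deriv b (X j \<omega> \<bullet> \<theta>) * (X j \<omega> \<bullet> v))"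
      by (simp add: fun_eq_iff score_def inner_sum_left left_diff_distrib)
    then show ?thesis unfolding quasi_loglik_def
      by (simp only:) (intro has_derivative_sum has_derivative_diff Yj b)
  qed
  then have "(\<lambda>v. score n \<omega> \<theta> \<bullet> v) = (\<lambda>v. 0)"
    using assms open_Theta by (intro differential_zero_maxmin[of \<theta> \<Theta> "H n \<omega>"]) auto
  then show ?thesis by (metis inner_eq_zero_iff)
qed

end

section \<open>Estimates on the good event\<close>

context quasi_glm
begin

definition info :: "nat \<Rightarrow> 'w \<Rightarrow> real ^ 'p \<Rightarrow> real ^ 'p ^ 'p" where
  "info n \<omega> \<theta> = (1 / real n) *\<^sub>R obs_info b X n \<omega> \<theta>"

text \<open>The good event, with \<theta> in the role of the estimator. The constant l bounds
  curvature from below; k bounds two envelope moments, the square controlling the information from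
  above and the cube the Taylor remainder; g bounds the score at \<open>\<theta>\<^sub>0\<close>,
  which controls the distance of \<theta> from \<open>\<theta>\<^sub>0\<close>.\<close>

definition regular :: "real \<Rightarrow> real \<Rightarrow> real \<Rightarrow> real ^ 'p \<Rightarrow> nat \<Rightarrow> 'w \<Rightarrow> real ^ 'p \<Rightarrow> bool" where
  "regular l k g \<theta>\<^sub>0 n \<omega> \<theta> \<longleftrightarrow> \<theta> \<in> \<Theta> \<and> (\<forall>\<theta>'\<in>\<Theta>. H n \<omega> \<theta>' \<le> H n \<omega> \<theta>) \<and>
     l \<le> lambda_min ((1 / real n) *\<^sub>R (\<Sum>j=1..n. b_low (X j \<omega>) *\<^sub>R outer (X j \<omega>))) \<and>
     (1 / real n) * (\<Sum>j=1..n. envelope (X j \<omega>) * (norm (X j \<omega>) ^ 2 + norm (X j \<omega>) ^ 3)) \<le> k \<and>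
     norm (score n \<omega> \<theta>\<^sub>0) \<le> g * sqrt (real n)"

lemma quadratic_form_info:
  "v \<bullet> (info n \<omega> \<theta> *v v) = (1 / real n) * (\<Sum>j=1..n. (deriv ^^ 2) b (X j \<omega> \<bullet> \<theta>) * (X j \<omega> \<bullet> v)\<^sup>2)"
  unfolding info_def obs_info_def by (rule quadratic_form_weighted_outer)

lemma transpose_info: "transpose (info n \<omega> \<theta>) = info n \<omega> \<theta>"
  unfolding info_def obs_info_def by (rule transpose_weighted_outer)

context
  fixes l k g \<theta>\<^sub>0 n \<omega> \<theta>
  assumes reg: "regular l k g \<theta>\<^sub>0 n \<omega> \<theta>" and n: "1 \<le> n" and l: "0 < l"
begin

lemma regular_in: "\<theta> \<in> \<Theta>" and regular_max: "\<theta>' \<in> \<Theta> \<Longrightarrow> H n \<omega> \<theta>' \<le> H n \<omega> \<theta>"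
  using reg by (auto simp: regular_def)

text \<open>The weights do not depend on the parameter, so the same bound serves for expansions
  around the maximiser and around \<open>\<theta>\<^sub>0\<close>.\<close>

lemma b_low_form_ge: "real n * l * (v \<bullet> v) \<le> (\<Sum>j=1..n. b_low (X j \<omega>) * (X j \<omega> \<bullet> v)\<^sup>2)"
proof -
  let ?A = "(1 / real n) *\<^sub>R (\<Sum>j=1..n. b_low (X j \<omega>) *\<^sub>R outer (X j \<omega>))"
  have "l * (v \<bullet> v) \<le> lambda_min ?A * (v \<bullet> v)"
    using reg by (intro mult_right_mono) (auto simp: regular_def)
  also have "\<dots> \<le> v \<bullet> (?A *v v)"
    by (rule lambda_min_le_quadratic_form[OF transpose_weighted_outer])
  also have "\<dots> = (1 / real n) * (\<Sum>j=1..n. b_low (X j \<omega>) * (X j \<omega> \<bullet> v)\<^sup>2)"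
    by (rule quadratic_form_weighted_outer)
  finally show ?thesis using n by (simp add: field_simps)
qed

lemma info_ge: "l * (v \<bullet> v) \<le> v \<bullet> (info n \<omega> \<theta> *v v)"
proof -
  have "real n * l * (v \<bullet> v) \<le> (\<Sum>j=1..n. b_low (X j \<omega>) * (X j \<omega> \<bullet> v)\<^sup>2)" by (rule b_low_form_ge)
  also have "\<dots> \<le> (\<Sum>j=1..n. (deriv ^^ 2) b (X j \<omega> \<bullet> \<theta>) * (X j \<omega> \<bullet> v)\<^sup>2)"
    by (intro sum_mono mult_right_mono b_low_le_deriv2 regular_in) auto
  finally show ?thesis using n by (simp add: quadratic_form_info field_simps)
qed

lemma envelope_moments:
  "(\<Sum>j=1..n. envelope (X j \<omega>) * norm (X j \<omega>) ^ 2) \<le> real n * k"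
  "(\<Sum>j=1..n. envelope (X j \<omega>) * norm (X j \<omega>) ^ 3) \<le> real n * k"
proof -
  have *: "(\<Sum>j=1..n. envelope (X j \<omega>) * (norm (X j \<omega>) ^ 2 + norm (X j \<omega>) ^ 3)) \<le> real n * k"
    using reg n by (simp add: regular_def field_simps)
  have "(\<Sum>j=1..n. envelope (X j \<omega>) * norm (X j \<omega>) ^ 2)
      \<le> (\<Sum>j=1..n. envelope (X j \<omega>) * (norm (X j \<omega>) ^ 2 + norm (X j \<omega>) ^ 3))"
    by (intro sum_mono mult_left_mono envelope_nonneg) simp
  with * show "(\<Sum>j=1..n. envelope (X j \<omega>) * norm (X j \<omega>) ^ 2) \<le> real n * k" by linarith
  have "(\<Sum>j=1..n. envelope (X j \<omega>) * norm (X j \<omega>) ^ 3)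
      \<le> (\<Sum>j=1..n. envelope (X j \<omega>) * (norm (X j \<omega>) ^ 2 + norm (X j \<omega>) ^ 3))"
    by (intro sum_mono mult_left_mono envelope_nonneg) simp
  with * show "(\<Sum>j=1..n. envelope (X j \<omega>) * norm (X j \<omega>) ^ 3) \<le> real n * k" by linarith
qed

text \<open>Keeps the Gaussian integral of the information away from 0, as required before taking
  logarithms.\<close>

lemma info_le: "v \<bullet> (info n \<omega> \<theta> *v v) \<le> k * (v \<bullet> v)"
proof -
  have "(\<Sum>j=1..n. (deriv ^^ 2) b (X j \<omega> \<bullet> \<theta>) * (X j \<omega> \<bullet> v)\<^sup>2)
      \<le> (\<Sum>j=1..n. (envelope (X j \<omega>) * norm (X j \<omega>) ^ 2) * (v \<bullet> v))"
  proof (rule sum_mono)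
    fix j
    have "(deriv ^^ 2) b (X j \<omega> \<bullet> \<theta>) * (X j \<omega> \<bullet> v)\<^sup>2 \<le> envelope (X j \<omega>) * ((X j \<omega> \<bullet> X j \<omega>) * (v \<bullet> v))"
      using abs_deriv_le_envelope[OF regular_in, of 2 "X j \<omega>"]
      by (intro mult_mono Cauchy_Schwarz_ineq envelope_nonneg) (auto simp: abs_le_iff)
    then show "(deriv ^^ 2) b (X j \<omega> \<bullet> \<theta>) * (X j \<omega> \<bullet> v)\<^sup>2
        \<le> (envelope (X j \<omega>) * norm (X j \<omega>) ^ 2) * (v \<bullet> v)"
      by (simp add: power2_norm_eq_inner mult.assoc)
  qed
  also have "\<dots> \<le> (real n * k) * (v \<bullet> v)"
    unfolding sum_distrib_right[symmetric] by (intro mult_right_mono envelope_moments) auto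
  finally show ?thesis using n by (simp add: quadratic_form_info field_simps)
qed

lemma loglik_decrement: "H n \<omega> \<theta> - H n \<omega> (\<theta> + v) = (\<Sum>j=1..n. bregman (X j \<omega>) \<theta> v)"
  using loglik_expansion[of n \<omega> \<theta> v] score_eq_0[OF regular_in regular_max] by simp

lemma loglik_decrement_ge:
  assumes "\<theta> + v \<in> \<Theta>"
  shows "real n * l * (v \<bullet> v) / 2 \<le> H n \<omega> \<theta> - H n \<omega> (\<theta> + v)"
proof -
  have "real n * l * (v \<bullet> v) / 2 \<le> (\<Sum>j=1..n. b_low (X j \<omega>) * (X j \<omega> \<bullet> v)\<^sup>2) / 2"
    using b_low_form_ge[of v] by simp
  also have "\<dots> \<le> (\<Sum>j=1..n. bregman (X j \<omega>) \<theta> v)"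
    unfolding sum_divide_distrib by (intro sum_mono bregman_ge regular_in assms)
  finally show ?thesis by (simp only: loglik_decrement)
qed

lemma loglik_decrement_approx:
  assumes "\<theta> + v \<in> \<Theta>"
  shows "\<bar>(H n \<omega> \<theta> - H n \<omega> (\<theta> + v)) - real n * (v \<bullet> (info n \<omega> \<theta> *v v)) / 2\<bar> \<le> real n * k * norm v ^ 3"
proof -
  have "real n * (v \<bullet> (info n \<omega> \<theta> *v v)) / 2
      = (\<Sum>j=1..n. (deriv ^^ 2) b (X j \<omega> \<bullet> \<theta>) * (X j \<omega> \<bullet> v)\<^sup>2 / 2)"
    using n by (simp add: quadratic_form_info sum_divide_distrib[symmetric])
  then have "\<bar>(H n \<omega> \<theta> - H n \<omega> (\<theta> + v)) - real n * (v \<bullet> (info n \<omega> \<theta> *v v)) / 2\<bar>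
      = \<bar>\<Sum>j=1..n. bregman (X j \<omega>) \<theta> v - (deriv ^^ 2) b (X j \<omega> \<bullet> \<theta>) * (X j \<omega> \<bullet> v)\<^sup>2 / 2\<bar>"
    by (simp only: loglik_decrement sum_subtractf)
  also have "\<dots> \<le> (\<Sum>j=1..n. \<bar>bregman (X j \<omega>) \<theta> v - (deriv ^^ 2) b (X j \<omega> \<bullet> \<theta>) * (X j \<omega> \<bullet> v)\<^sup>2 / 2\<bar>)"
    by (rule sum_abs)
  also have "\<dots> \<le> (\<Sum>j=1..n. envelope (X j \<omega>) * norm (X j \<omega>) ^ 3 * norm v ^ 3)"
    by (intro sum_mono bregman_quadratic_approx regular_in assms)
  also have "\<dots> \<le> (real n * k) * norm v ^ 3"
    unfolding sum_distrib_right[symmetric] by (intro mult_right_mono envelope_moments) auto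
  finally show ?thesis .
qed

lemma estimator_consistent:
  assumes "\<theta>\<^sub>0 \<in> \<Theta>"
  shows "norm (\<theta> - \<theta>\<^sub>0) * sqrt (real n) \<le> 2 * g / l"
proof (cases "\<theta> = \<theta>\<^sub>0")
  case True
  \<comment> \<open>The sign of \<open>g\<close> is recovered from the norm that it bounds.\<close>
  have "0 \<le> g * sqrt (real n)" using reg by (auto simp: regular_def intro: order_trans[OF norm_ge_zero])
  then have "0 \<le> g" using n by (simp add: zero_le_mult_iff)
  with True l show ?thesis by simp
next
  case False
  define v where "v = \<theta> - \<theta>\<^sub>0"
  have v: "norm v > 0" using False by (simp add: v_def)
  have th: "\<theta>\<^sub>0 + v = \<theta>" by (simp add: v_def)
  have "real n * l * (v \<bullet> v) / 2 \<le> (\<Sum>j=1..n. b_low (X j \<omega>) * (X j \<omega> \<bullet> v)\<^sup>2) / 2"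
    using b_low_form_ge[of v] by simp
  also have "\<dots> \<le> (\<Sum>j=1..n. bregman (X j \<omega>) \<theta>\<^sub>0 v)"
    unfolding sum_divide_distrib using assms th regular_in by (intro sum_mono bregman_ge) auto
  \<comment> \<open>As \<open>\<theta>\<^sub>0 + v\<close> is the maximiser, the log-likelihood does
    not drop from \<open>\<theta>\<^sub>0\<close> to it, so the linear term outweighs the Bregman
    sum.\<close>
  also have "\<dots> \<le> score n \<omega> \<theta>\<^sub>0 \<bullet> v"
    using loglik_expansion[of n \<omega> \<theta>\<^sub>0 v] regular_max[OF assms] by (simp add: th)
  also have "\<dots> \<le> norm (score n \<omega> \<theta>\<^sub>0) * norm v" by (rule norm_cauchy_schwarz)
  also have "\<dots> \<le> (g * sqrt (real n)) * norm v"
    using reg by (intro mult_right_mono) (auto simp: regular_def)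
  finally have "(sqrt (real n) * norm v) * (sqrt (real n) * norm v * l)
      \<le> (sqrt (real n) * norm v) * (2 * g)"
    by (simp add: power2_norm_eq_inner[symmetric] power2_eq_square mult_ac)
  then have "sqrt (real n) * norm v * l \<le> 2 * g"
    using v n by (subst (asm) mult_le_cancel_left_pos) auto
  then show ?thesis using l by (simp add: v_def field_simps)
qed

end

end

section \<open>Laplace approximation of the integral against the prior\<close>

locale quasi_glm_prior = quasi_glm \<Theta> b b_low C K r X Y
  for \<Theta> :: "(real ^ 'p) set" and b b_low C K r and X :: "nat \<Rightarrow> 'w \<Rightarrow> real ^ 'p" and Y +
  fixes prior :: "real ^ 'p \<Rightarrow> real" and \<theta>\<^sub>0 :: "real ^ 'p" and P :: real
  assumes theta0: "\<theta>\<^sub>0 \<in> \<Theta>"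
    and prior_measurable: "(\<lambda>\<theta>. indicator \<Theta> \<theta> * prior \<theta>) \<in> borel_measurable borel"
    and prior_nonneg: "\<And>\<theta>. \<theta> \<in> \<Theta> \<Longrightarrow> 0 \<le> prior \<theta>"
    and prior_le: "\<And>\<theta>. \<theta> \<in> \<Theta> \<Longrightarrow> prior \<theta> \<le> P"
    and prior_pos: "0 < prior \<theta>\<^sub>0"
    and prior_cont: "\<And>m. m > 0 \<Longrightarrow>
        (\<lambda>n. SUP u\<in>{u. norm u < m}. \<bar>prior (\<theta>\<^sub>0 + u /\<^sub>R sqrt (real n)) - prior \<theta>\<^sub>0\<bar>) \<longlonglongrightarrow> 0"
begin

lemma P_pos: "0 < P"
  using prior_pos prior_le[OF theta0] by linarith

lemma prior_close:
  assumes "0 < m" "0 < \<epsilon>"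
  shows "\<forall>\<^sub>F n in sequentially. \<forall>u. norm u < m \<longrightarrow>
    \<theta>\<^sub>0 + u /\<^sub>R sqrt (real n) \<in> \<Theta> \<and> \<bar>prior (\<theta>\<^sub>0 + u /\<^sub>R sqrt (real n)) - prior \<theta>\<^sub>0\<bar> \<le> \<epsilon>"
proof -
  obtain \<rho> where \<rho>: "0 < \<rho>" "ball \<theta>\<^sub>0 \<rho> \<subseteq> \<Theta>"
    using open_Theta theta0 open_contains_ball by metis
  have "(\<lambda>n. m / sqrt (real n)) \<longlonglongrightarrow> 0" by real_asymp
  then have "\<forall>\<^sub>F n in sequentially. m / sqrt (real n) < \<rho>" using \<rho> by (intro order_tendstoD(2)) auto
  moreover have "\<forall>\<^sub>F n in sequentially.
      (SUP u\<in>{u. norm u < m}. \<bar>prior (\<theta>\<^sub>0 + u /\<^sub>R sqrt (real n)) - prior \<theta>\<^sub>0\<bar>) < \<epsilon>"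
    using prior_cont[OF assms(1)] assms(2) by (intro order_tendstoD(2)) auto
  ultimately show ?thesis using eventually_gt_at_top[of 0]
  proof eventually_elim
    case (elim n)
    have in_Theta: "\<theta>\<^sub>0 + u /\<^sub>R sqrt (real n) \<in> \<Theta>" if "norm u < m" for u :: "real ^ 'p"
    proof -
      have "norm (u /\<^sub>R sqrt (real n)) = norm u / sqrt (real n)" using elim by (simp add: divide_inverse mult.commute)
      also have "\<dots> \<le> m / sqrt (real n)" using that by (intro divide_right_mono) auto
      finally show ?thesis using elim \<rho> by (intro subsetD[OF \<rho>(2)]) (simp add: dist_norm)
    qed
    \<comment> \<open>The supremum bounds its members only if the family is bounded above. This
      holds once the shrinking ball lies inside \<Theta>, where the prior takes values between 0 and
      P.\<close>
    have bdd: "bdd_above ((\<lambda>u. \<bar>prior (\<theta>\<^sub>0 + u /\<^sub>R sqrt (real n)) - prior \<theta>\<^sub>0\<bar>) ` {u. norm u < m})"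
    proof (rule bdd_aboveI2[of _ _ P])
      fix u :: "real ^ 'p" assume "u \<in> {u. norm u < m}"
      then have "\<theta>\<^sub>0 + u /\<^sub>R sqrt (real n) \<in> \<Theta>" using in_Theta by simp
      then show "\<bar>prior (\<theta>\<^sub>0 + u /\<^sub>R sqrt (real n)) - prior \<theta>\<^sub>0\<bar> \<le> P"
        using prior_nonneg[OF theta0] prior_le[OF theta0] prior_nonneg prior_le
        by (smt (verit))
    qed
    show ?case
    proof (intro allI impI conjI)
      fix u :: "real ^ 'p" assume u: "norm u < m"
      then show "\<theta>\<^sub>0 + u /\<^sub>R sqrt (real n) \<in> \<Theta>" by (rule in_Theta)
      have "\<bar>prior (\<theta>\<^sub>0 + u /\<^sub>R sqrt (real n)) - prior \<theta>\<^sub>0\<bar>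
          \<le> (SUP u\<in>{u. norm u < m}. \<bar>prior (\<theta>\<^sub>0 + u /\<^sub>R sqrt (real n)) - prior \<theta>\<^sub>0\<bar>)"
        using u by (intro cSUP_upper bdd) auto
      with elim(2) show "\<bar>prior (\<theta>\<^sub>0 + u /\<^sub>R sqrt (real n)) - prior \<theta>\<^sub>0\<bar> \<le> \<epsilon>" by linarith
    qed
  qed
qed

text \<open>The integrand of the evidence in the coordinate u = sqrt(n) (\<theta>' - \<theta>),
  divided by the likelihood at the centre \<theta>. The indicator extends it by 0, so the domain of
  integration does not move with n or the sample.\<close>

definition weight :: "nat \<Rightarrow> 'w \<Rightarrow> real ^ 'p \<Rightarrow> real ^ 'p \<Rightarrow> real" where
  "weight n \<omega> \<theta> u = (let \<theta>' = \<theta> + (1 / sqrt (real n)) *\<^sub>R u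
     in exp (H n \<omega> \<theta>' - H n \<omega> \<theta>) * (indicator \<Theta> \<theta>' * prior \<theta>'))"

lemma borel_measurable_loglik [measurable]: "H n \<omega> \<in> borel_measurable borel"
  by (intro borel_measurable_continuous_onI continuous_on_loglik)

lemma borel_measurable_weight [measurable]: "weight n \<omega> \<theta> \<in> borel_measurable borel"
  unfolding weight_def[abs_def] Let_def
  by (intro borel_measurable_times borel_measurable_exp borel_measurable_diff
      measurable_compose[OF _ borel_measurable_loglik] measurable_compose[OF _ prior_measurable]) auto

text \<open>At v = u/sqrt(n) the factors n cancel, so the Gaussian majorant depends neither on n nor
  on the outcome; outside \<Theta> the weight is 0.\<close>

lemma weight_bound:
  assumes reg: "regular l k g \<theta>\<^sub>0 n \<omega> \<theta>" and n: "1 \<le> n" and l: "0 < l"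
  shows "\<bar>weight n \<omega> \<theta> u\<bar> \<le> P * exp (- (l * (u \<bullet> u)) / 2)"
proof (cases "\<theta> + (1 / sqrt (real n)) *\<^sub>R u \<in> \<Theta>")
  case True
  have "l * (u \<bullet> u) / 2 \<le> H n \<omega> \<theta> - H n \<omega> (\<theta> + (1 / sqrt (real n)) *\<^sub>R u)"
    using loglik_decrement_ge[OF reg n l True] n by (simp add: field_simps)
  then have "exp (H n \<omega> (\<theta> + (1 / sqrt (real n)) *\<^sub>R u) - H n \<omega> \<theta>) \<le> exp (- (l * (u \<bullet> u)) / 2)"
    by simp
  with True prior_nonneg[OF True] prior_le[OF True] P_pos show ?thesis
    by (simp add: weight_def Let_def abs_mult mult.commute[of P] mult_mono)
qed (use P_pos in \<open>auto simp: weight_def Let_def\<close>)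

lemma weight_local:
  assumes l: "0 < l" and k: "0 \<le> k" and g: "0 \<le> g" and m: "0 < m" and \<delta>: "0 < \<delta>"
  shows "\<forall>\<^sub>F n in sequentially. \<forall>\<omega> \<theta> u. regular l k g \<theta>\<^sub>0 n \<omega> \<theta> \<longrightarrow> norm u \<le> m \<longrightarrow>
    \<bar>weight n \<omega> \<theta> u - prior \<theta>\<^sub>0 * exp (- (u \<bullet> (info n \<omega> \<theta> *v u)) / 2)\<bar> \<le> \<delta>"
proof -
  \<comment> \<open>The maximiser is within 2g/l of \<open>\<theta>\<^sub>0\<close> on the scale
    1/sqrt(n). A displacement of size m from it therefore has size at most m + 2g/l as seen from
    \<open>\<theta>\<^sub>0\<close>; the extra 1 makes the inequality strict.\<close>
  define R where "R = m + 2 * g / l + 1"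
  have R: "0 < R" using l g m by (auto simp: R_def intro!: add_pos_nonneg)
  have "(\<lambda>n. P * k * m ^ 3 / sqrt (real n)) \<longlonglongrightarrow> 0" by real_asymp
  then have "\<forall>\<^sub>F n in sequentially. P * k * m ^ 3 / sqrt (real n) < \<delta> / 2"
    using \<delta> by (intro order_tendstoD(2)) auto
  moreover have "0 < \<delta> / 2" using \<delta> by simp
  note prior_close[OF R this]
  ultimately show ?thesis using eventually_ge_at_top[of 1]
  proof (eventually_elim, intro allI impI)
    fix n \<omega> \<theta> and u :: "real ^ 'p"
    assume small: "P * k * m ^ 3 / sqrt (real n) < \<delta> / 2"
      and close: "\<forall>u. norm u < R \<longrightarrow> \<theta>\<^sub>0 + u /\<^sub>R sqrt (real n) \<in> \<Theta> \<and>
        \<bar>prior (\<theta>\<^sub>0 + u /\<^sub>R sqrt (real n)) - prior \<theta>\<^sub>0\<bar> \<le> \<delta> / 2"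
      and n: "1 \<le> n" and reg: "regular l k g \<theta>\<^sub>0 n \<omega> \<theta>" and u: "norm u \<le> m"
    let ?v = "(1 / sqrt (real n)) *\<^sub>R u"
    \<comment> \<open>The same point in coordinates centred at \<open>\<theta>\<^sub>0\<close>,
      where the continuity of the prior is available.\<close>
    define u' where "u' = sqrt (real n) *\<^sub>R (\<theta> - \<theta>\<^sub>0) + u"
    have "norm u' \<le> norm (\<theta> - \<theta>\<^sub>0) * sqrt (real n) + norm u"
      using norm_triangle_ineq[of "sqrt (real n) *\<^sub>R (\<theta> - \<theta>\<^sub>0)" u] by (simp add: u'_def mult.commute)
    also have "\<dots> < R" using estimator_consistent[OF reg n l theta0] u by (simp add: R_def)
    finally have u': "norm u' < R" .
    have eq: "\<theta>\<^sub>0 + u' /\<^sub>R sqrt (real n) = \<theta> + ?v"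
      using n by (simp add: u'_def scaleR_right_distrib divide_inverse)
    from close u' have in_Theta: "\<theta> + ?v \<in> \<Theta>" and pr: "\<bar>prior (\<theta> + ?v) - prior \<theta>\<^sub>0\<bar> \<le> \<delta> / 2"
      unfolding eq[symmetric] by blast+
    define h where "h = H n \<omega> \<theta> - H n \<omega> (\<theta> + ?v)"
    define q where "q = u \<bullet> (info n \<omega> \<theta> *v u) / 2"
    have h0: "0 \<le> h" using regular_max[OF reg n l in_Theta] by (simp add: h_def)
    have q0: "0 \<le> q" using info_ge[OF reg n l, of u] l
      by (simp add: q_def) (metis inner_ge_zero less_imp_le mult_nonneg_nonneg order_trans)
    \<comment> \<open>At v = u/sqrt(n) the cubic remainder n |v|^3 becomes |u|^3/sqrt(n), which
      vanishes uniformly on the ball of radius m.\<close>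
    have "\<bar>h - q\<bar> \<le> real n * k * norm ?v ^ 3"
      using loglik_decrement_approx[OF reg n l in_Theta] n
      by (simp add: h_def q_def matrix_vector_mult_scaleR)
    also have "\<dots> = k * norm u ^ 3 / sqrt (real n)"
      using n by (simp add: power_divide power3_eq_cube)
    also have "\<dots> \<le> k * m ^ 3 / sqrt (real n)"
      using u k by (intro divide_right_mono mult_left_mono power_mono) auto
    finally have hq: "\<bar>h - q\<bar> \<le> k * m ^ 3 / sqrt (real n)" .
    have w: "weight n \<omega> \<theta> u = exp (- h) * prior (\<theta> + ?v)"
      using in_Theta by (simp add: weight_def Let_def h_def)
    have "\<bar>weight n \<omega> \<theta> u - prior \<theta>\<^sub>0 * exp (- q)\<bar>
        = \<bar>(exp (- h) - exp (- q)) * prior (\<theta> + ?v) + exp (- q) * (prior (\<theta> + ?v) - prior \<theta>\<^sub>0)\<bar>"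
      by (simp add: w algebra_simps)
    also have "\<dots> \<le> \<bar>exp (- h) - exp (- q)\<bar> * \<bar>prior (\<theta> + ?v)\<bar> + exp (- q) * \<bar>prior (\<theta> + ?v) - prior \<theta>\<^sub>0\<bar>"
      by (intro order_trans[OF abs_triangle_ineq]) (simp add: abs_mult)
    also have "\<dots> \<le> (k * m ^ 3 / sqrt (real n)) * P + 1 * (\<delta> / 2)"
    proof (rule add_mono)
      show "\<bar>exp (- h) - exp (- q)\<bar> * \<bar>prior (\<theta> + ?v)\<bar> \<le> (k * m ^ 3 / sqrt (real n)) * P"
        using abs_exp_minus_diff_le[OF h0 q0] hq prior_nonneg[OF in_Theta] prior_le[OF in_Theta]
        by (intro mult_mono) auto
      show "exp (- q) * \<bar>prior (\<theta> + ?v) - prior \<theta>\<^sub>0\<bar> \<le> 1 * (\<delta> / 2)"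
        using pr q0 by (intro mult_mono) auto
    qed
    also have "\<dots> = P * k * m ^ 3 / sqrt (real n) + \<delta> / 2" by (simp add: mult_ac)
    also have "\<dots> \<le> \<delta>" using small by linarith
    finally show "\<bar>weight n \<omega> \<theta> u - prior \<theta>\<^sub>0 * exp (- (u \<bullet> (info n \<omega> \<theta> *v u)) / 2)\<bar> \<le> \<delta>"
      by (simp add: q_def)
  qed
qed

text \<open>Since m and \<delta> depend only on the Gaussian majorant and \<epsilon>, the threshold
  for n obtained on the ball of radius m serves all outcomes and maximisers at once.\<close>

lemma weight_laplace:
  assumes l: "0 < l" and k: "0 \<le> k" and g: "0 \<le> g" and \<epsilon>: "0 < \<epsilon>"
  shows "\<forall>\<^sub>F n in sequentially. \<forall>\<omega> \<theta>. regular l k g \<theta>\<^sub>0 n \<omega> \<theta> \<longrightarrow>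
    \<bar>(\<integral>u. weight n \<omega> \<theta> u \<partial>lborel)
      - (\<integral>u. prior \<theta>\<^sub>0 * exp (- (u \<bullet> (info n \<omega> \<theta> *v u)) / 2) \<partial>lborel)\<bar> \<le> \<epsilon>"
proof -
  have "integrable lborel (\<lambda>u :: real ^ 'p. P * exp (- (l * (u \<bullet> u)) / 2))"
    by (intro integrable_mult_right isotropic_gaussian_integral(1) l)
  from integral_diff_small_of_close_on_ball[OF this \<epsilon>]
  obtain m \<delta> where m: "0 < m" "0 < \<delta>" and close:
    "\<And>w v :: real ^ 'p \<Rightarrow> real. w \<in> borel_measurable borel \<Longrightarrow> v \<in> borel_measurable borel \<Longrightarrow>
      (\<And>u. \<bar>w u\<bar> \<le> P * exp (- (l * (u \<bullet> u)) / 2)) \<Longrightarrow> (\<And>u. \<bar>v u\<bar> \<le> P * exp (- (l * (u \<bullet> u)) / 2)) \<Longrightarrow>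
      (\<And>u. norm u \<le> m \<Longrightarrow> \<bar>w u - v u\<bar> \<le> \<delta>) \<Longrightarrow>
      \<bar>(\<integral>u. w u \<partial>lborel) - (\<integral>u. v u \<partial>lborel)\<bar> \<le> \<epsilon>" by blast
  show ?thesis using weight_local[OF l k g m] eventually_ge_at_top[of 1]
  proof (eventually_elim, intro allI impI)
    fix n \<omega> \<theta>
    assume loc: "\<forall>\<omega> \<theta> u. regular l k g \<theta>\<^sub>0 n \<omega> \<theta> \<longrightarrow> norm u \<le> m \<longrightarrow>
        \<bar>weight n \<omega> \<theta> u - prior \<theta>\<^sub>0 * exp (- (u \<bullet> (info n \<omega> \<theta> *v u)) / 2)\<bar> \<le> \<delta>"
      and n: "1 \<le> n" and reg: "regular l k g \<theta>\<^sub>0 n \<omega> \<theta>"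
    show "\<bar>(\<integral>u. weight n \<omega> \<theta> u \<partial>lborel)
      - (\<integral>u. prior \<theta>\<^sub>0 * exp (- (u \<bullet> (info n \<omega> \<theta> *v u)) / 2) \<partial>lborel)\<bar> \<le> \<epsilon>"
    proof (rule close)
      show "\<bar>weight n \<omega> \<theta> u\<bar> \<le> P * exp (- (l * (u \<bullet> u)) / 2)" for u
        by (rule weight_bound[OF reg n l])
      show "\<bar>prior \<theta>\<^sub>0 * exp (- (u \<bullet> (info n \<omega> \<theta> *v u)) / 2)\<bar> \<le> P * exp (- (l * (u \<bullet> u)) / 2)" for u
        using prior_pos prior_le[OF theta0] info_ge[OF reg n l, of u]
        by (simp add: abs_mult mult_mono)
      show "\<bar>weight n \<omega> \<theta> u - prior \<theta>\<^sub>0 * exp (- (u \<bullet> (info n \<omega> \<theta> *v u)) / 2)\<bar> \<le> \<delta>" if "norm u \<le> m" for u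
        using loc reg that by blast
    qed measurable
  qed
qed

text \<open>The affine substitution is exact for any centre; its Jacobian n^(-p/2) is the source of
  the term -(p/2) log n.\<close>

lemma evidence_eq:
  assumes "1 \<le> n"
  shows "(LINT \<theta>':\<Theta>|lborel. exp (H n \<omega> \<theta>') * prior \<theta>')
    = exp (H n \<omega> \<theta>) * (1 / sqrt (real n)) ^ CARD('p) * (\<integral>u. weight n \<omega> \<theta> u \<partial>lborel)"
proof -
  have [measurable]: "(\<lambda>\<theta>. indicator \<Theta> \<theta> * prior \<theta>) \<in> borel_measurable borel" by (rule prior_measurable)
  have "(LINT \<theta>':\<Theta>|lborel. exp (H n \<omega> \<theta>') * prior \<theta>')
      = (\<integral>\<theta>'. exp (H n \<omega> \<theta>') * (indicator \<Theta> \<theta>' * prior \<theta>') \<partial>lborel)"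
    unfolding set_lebesgue_integral_def by (intro Bochner_Integration.integral_cong) auto
  also have "\<dots> = (1 / sqrt (real n)) ^ CARD('p) *
      (\<integral>u. (\<lambda>\<theta>'. exp (H n \<omega> \<theta>') * (indicator \<Theta> \<theta>' * prior \<theta>')) (\<theta> + (1 / sqrt (real n)) *\<^sub>R u) \<partial>lborel)"
    by (subst lborel_integral_affine[of "1 / sqrt (real n)" _ \<theta>]) (use assms in auto)
  also have "(\<integral>u. (\<lambda>\<theta>'. exp (H n \<omega> \<theta>') * (indicator \<Theta> \<theta>' * prior \<theta>')) (\<theta> + (1 / sqrt (real n)) *\<^sub>R u) \<partial>lborel)
      = (\<integral>u. exp (H n \<omega> \<theta>) * weight n \<omega> \<theta> u \<partial>lborel)"
    by (intro Bochner_Integration.integral_cong)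
      (auto simp: weight_def Let_def exp_diff)
  finally show ?thesis by simp
qed

lemma log_evidence_approx:
  assumes l: "0 < l" and k: "0 < k" and g: "0 \<le> g" and \<epsilon>: "0 < \<epsilon>"
  shows "\<forall>\<^sub>F n in sequentially. \<forall>\<omega> \<theta>. regular l k g \<theta>\<^sub>0 n \<omega> \<theta> \<longrightarrow>
    0 < (LINT \<theta>':\<Theta>|lborel. exp (H n \<omega> \<theta>') * prior \<theta>') \<and> 0 < det (info n \<omega> \<theta>) \<and> 0 < prior \<theta> \<and>
    \<bar>ln (LINT \<theta>':\<Theta>|lborel. exp (H n \<omega> \<theta>') * prior \<theta>')
      - (H n \<omega> \<theta> - real CARD('p) / 2 * ln (real n) + real CARD('p) / 2 * ln (2 * pi)
         - 1 / 2 * ln (det (info n \<omega> \<theta>)) + ln (prior \<theta>))\<bar> \<le> \<epsilon>"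
proof -
  \<comment> \<open>The Gaussian integral for the largest admissible information k times the
    identity; it bounds every Gaussian integral on the good event from below.\<close>
  define G where "G = (\<integral>(u :: real ^ 'p). exp (- (k * (u \<bullet> u)) / 2) \<partial>lborel)"
  have G: "0 < G" unfolding G_def by (rule isotropic_gaussian_integral(2)[OF k])
  define L where "L = prior \<theta>\<^sub>0 * G"
  have L: "0 < L" using G prior_pos by (simp add: L_def)
  \<comment> \<open>Half of \<epsilon> pays for the logarithm of the integral, the other half for
    the prior via \<open>e2\<close>. The minimum with L/2 meets the smallness condition of
    \<open>abs_ln_diff_le\<close>.\<close>
  define e1 where "e1 = min (L / 2) (\<epsilon> * L / 4)"
  have e1: "0 < e1" "e1 \<le> L / 2" "2 * e1 / L \<le> \<epsilon> / 2"
    using L \<epsilon> by (auto simp: e1_def field_simps min_def)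
  define e2 where "e2 = min (prior \<theta>\<^sub>0 / 2) (\<epsilon> * prior \<theta>\<^sub>0 / 4)"
  have e2: "0 < e2" "e2 \<le> prior \<theta>\<^sub>0 / 2" "2 * e2 / prior \<theta>\<^sub>0 \<le> \<epsilon> / 2"
    using prior_pos \<epsilon> by (auto simp: e2_def field_simps min_def)
  \<comment> \<open>A window around \<open>\<theta>\<^sub>0\<close> containing the maximiser itself,
    so that the prior at \<open>\<theta>\<^sub>0\<close> can be exchanged for the prior at the
    maximiser.\<close>
  define R where "R = 2 * g / l + 1"
  have R: "0 < R" using l g by (auto simp: R_def intro!: add_nonneg_pos)
  show ?thesis
    using weight_laplace[OF l less_imp_le[OF k] g e1(1)] prior_close[OF R e2(1)] eventually_ge_at_top[of 1]
  proof (eventually_elim, intro allI impI)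
    fix n \<omega> \<theta>
    assume lap: "\<forall>\<omega> \<theta>. regular l k g \<theta>\<^sub>0 n \<omega> \<theta> \<longrightarrow>
        \<bar>(\<integral>u. weight n \<omega> \<theta> u \<partial>lborel)
          - (\<integral>u. prior \<theta>\<^sub>0 * exp (- (u \<bullet> (info n \<omega> \<theta> *v u)) / 2) \<partial>lborel)\<bar> \<le> e1"
      and close: "\<forall>u. norm u < R \<longrightarrow> \<theta>\<^sub>0 + u /\<^sub>R sqrt (real n) \<in> \<Theta> \<and>
        \<bar>prior (\<theta>\<^sub>0 + u /\<^sub>R sqrt (real n)) - prior \<theta>\<^sub>0\<bar> \<le> e2"
      and n: "1 \<le> n" and reg: "regular l k g \<theta>\<^sub>0 n \<omega> \<theta>"
    let ?A = "info n \<omega> \<theta>"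
    define W where "W = (\<integral>u. weight n \<omega> \<theta> u \<partial>lborel)"
    define D where "D = sqrt (2 * pi) ^ CARD('p) / sqrt (det ?A)"
    have pos: "0 < v \<bullet> (?A *v v)" if "v \<noteq> 0" for v
      using info_ge[OF reg n l, of v] l that by (meson inner_gt_zero_iff mult_pos_pos order_less_le_trans)
    note gauss = gaussian_integral[OF transpose_info pos]
    have int: "integrable lborel (\<lambda>u. exp (- (u \<bullet> (?A *v u)) / 2))"
      and val: "(\<integral>u. exp (- (u \<bullet> (?A *v u)) / 2) \<partial>lborel) = D"
      using gauss(2) by (auto simp: has_bochner_integral_iff D_def)
    have det: "0 < det ?A" by (rule gauss(1))
    have "G \<le> D" unfolding G_def val[symmetric]
      using info_le[OF reg n l] by (intro integral_mono int isotropic_gaussian_integral(1)[OF k]) auto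
    then have LD: "L \<le> prior \<theta>\<^sub>0 * D" using prior_pos by (simp add: L_def)
    have "\<bar>W - prior \<theta>\<^sub>0 * D\<bar> \<le> e1" using lap[rule_format, OF reg] unfolding W_def integral_mult_right_zero val .
    from abs_ln_diff_le[OF L LD this e1(2)]
    have W: "0 < W" and lnW: "\<bar>ln W - ln (prior \<theta>\<^sub>0 * D)\<bar> \<le> \<epsilon> / 2" using e1(3) by linarith+
    have D: "0 < D" using det by (simp add: D_def)
    have lnD: "ln D = real CARD('p) / 2 * ln (2 * pi) - 1 / 2 * ln (det ?A)"
      using det by (simp add: D_def ln_div ln_realpow ln_sqrt)
    have "\<bar>prior \<theta> - prior \<theta>\<^sub>0\<bar> \<le> e2"
    proof -
      have "norm (sqrt (real n) *\<^sub>R (\<theta> - \<theta>\<^sub>0)) < R"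
        using estimator_consistent[OF reg n l theta0] by (simp add: R_def mult.commute)
      moreover have "\<theta>\<^sub>0 + (sqrt (real n) *\<^sub>R (\<theta> - \<theta>\<^sub>0)) /\<^sub>R sqrt (real n) = \<theta>" using n by simp
      ultimately show ?thesis using close by metis
    qed
    from abs_ln_diff_le[OF prior_pos order_refl this e2(2)]
    have pr: "0 < prior \<theta>" and lnpr: "\<bar>ln (prior \<theta>) - ln (prior \<theta>\<^sub>0)\<bar> \<le> \<epsilon> / 2" using e2(3) by linarith+
    let ?J = "LINT \<theta>':\<Theta>|lborel. exp (H n \<omega> \<theta>') * prior \<theta>'"
    have J: "?J = exp (H n \<omega> \<theta>) * (1 / sqrt (real n)) ^ CARD('p) * W"
      unfolding W_def by (rule evidence_eq[OF n])
    have Jpos: "0 < ?J" using W n by (simp add: J)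
    have lnJ: "ln ?J = H n \<omega> \<theta> - real CARD('p) / 2 * ln (real n) + ln W"
      using W n by (simp add: J ln_mult ln_realpow ln_div ln_sqrt)
    have "\<bar>ln ?J - (H n \<omega> \<theta> - real CARD('p) / 2 * ln (real n) + real CARD('p) / 2 * ln (2 * pi)
         - 1 / 2 * ln (det ?A) + ln (prior \<theta>))\<bar> = \<bar>(ln W - ln (prior \<theta>\<^sub>0 * D)) - (ln (prior \<theta>) - ln (prior \<theta>\<^sub>0))\<bar>"
      unfolding lnJ ln_mult_pos[OF prior_pos D] lnD by (rule arg_cong[of _ _ abs]) simp
    also have "\<dots> \<le> \<epsilon>" using lnW lnpr by linarith
    finally show "0 < ?J \<and> 0 < det ?A \<and> 0 < prior \<theta> \<and>
      \<bar>ln ?J - (H n \<omega> \<theta> - real CARD('p) / 2 * ln (real n) + real CARD('p) / 2 * ln (2 * pi)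
         - 1 / 2 * ln (det ?A) + ln (prior \<theta>))\<bar> \<le> \<epsilon>"
      using Jpos det pr by blast
  qed
qed

end

section \<open>Boundedness in probability\<close>

text \<open>The exceptional event is only covered by a measurable set, so \<open>P n\<close> need not be measurable.\<close>

definition mostly :: "'w measure \<Rightarrow> real \<Rightarrow> (nat \<Rightarrow> 'w \<Rightarrow> bool) \<Rightarrow> bool" where
  "mostly M \<eta> P \<longleftrightarrow> (\<forall>\<^sub>F n in sequentially. \<exists>B\<in>sets M. measure M B < \<eta> \<and> (\<forall>\<omega>\<in>space M - B. P n \<omega>))"

lemma mostly_mono:
  assumes "mostly M \<eta> P" "\<forall>\<^sub>F n in sequentially. \<forall>\<omega>\<in>space M. P n \<omega> \<longrightarrow> Q n \<omega>"
  shows "mostly M \<eta> Q"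
  using assms unfolding mostly_def
proof eventually_elim
  case (elim n)
  then show ?case by blast
qed

context prob_space
begin

lemma mostly_conj:
  assumes "mostly M \<eta> P" "mostly M \<eta>' Q"
  shows "mostly M (\<eta> + \<eta>') (\<lambda>n \<omega>. P n \<omega> \<and> Q n \<omega>)"
  using assms unfolding mostly_def
proof eventually_elim
  case (elim n)
  then obtain B B' where B: "B \<in> sets M" "prob B < \<eta>" "\<forall>\<omega>\<in>space M - B. P n \<omega>"
    and B': "B' \<in> sets M" "prob B' < \<eta>'" "\<forall>\<omega>\<in>space M - B'. Q n \<omega>" by blast
  have "prob (B \<union> B') \<le> prob B + prob B'" using B B' by (intro measure_Un_le)
  then show ?case using B B' by (intro bexI[of _ "B \<union> B'"]) auto
qed

lemma mostly_AE:
  assumes "\<And>n. 1 \<le> n \<Longrightarrow> AE \<omega> in M. P n \<omega>" "0 < \<eta>"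
  shows "mostly M \<eta> P"
  unfolding mostly_def using eventually_ge_at_top[of 1]
proof eventually_elim
  case (elim n)
  from AE_E[OF assms(1)[OF elim]] obtain N where "{\<omega> \<in> space M. \<not> P n \<omega>} \<subseteq> N" "emeasure M N = 0" "N \<in> sets M"
    by blast
  then show ?case using assms(2) by (intro bexI[of _ N]) (auto simp: measure_def)
qed

lemma mostly_sets:
  assumes "\<forall>\<^sub>F n in sequentially. {\<omega> \<in> space M. \<not> P n \<omega>} \<in> sets M"
    "\<forall>\<^sub>F n in sequentially. prob {\<omega> \<in> space M. \<not> P n \<omega>} < \<eta>"
  shows "mostly M \<eta> P"
  unfolding mostly_def using assms
proof eventually_elim
  case (elim n)
  then show ?case by (intro bexI[of _ "{\<omega> \<in> space M. \<not> P n \<omega>}"]) auto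
qed

lemma small_oP_I:
  assumes "\<And>\<epsilon> \<eta>. 0 < \<epsilon> \<Longrightarrow> 0 < \<eta> \<Longrightarrow> mostly M \<eta> (\<lambda>n \<omega>. \<bar>Z n \<omega>\<bar> \<le> ereal \<epsilon>)"
  shows "small_oP M Z"
  unfolding small_oP_def
proof (intro allI impI)
  fix \<epsilon> :: real assume \<epsilon>: "0 < \<epsilon>"
  show "(\<lambda>n. prob {\<omega> \<in> space M. ereal \<epsilon> < \<bar>Z n \<omega>\<bar>}) \<longlonglongrightarrow> 0"
  proof (rule order_tendstoI)
    fix \<eta> :: real assume "0 < \<eta>"
    from assms[OF \<epsilon> this] show "\<forall>\<^sub>F n in sequentially. prob {\<omega> \<in> space M. ereal \<epsilon> < \<bar>Z n \<omega>\<bar>} < \<eta>"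
      unfolding mostly_def
    proof eventually_elim
      case (elim n)
      then obtain B where B: "B \<in> sets M" "prob B < \<eta>" "\<forall>\<omega>\<in>space M - B. \<bar>Z n \<omega>\<bar> \<le> ereal \<epsilon>" by blast
      then have "{\<omega> \<in> space M. ereal \<epsilon> < \<bar>Z n \<omega>\<bar>} \<subseteq> B" by force
      \<comment> \<open>Monotonicity asks for measurability of the covering set \<open>B\<close>
        only, so the remainder may be an arbitrary function of the outcome.\<close>
      with B show ?case using finite_measure_mono[of "{\<omega> \<in> space M. ereal \<epsilon> < \<bar>Z n \<omega>\<bar>}" B] by linarith
    qed
  next
    fix a :: real assume "a < 0"
    then show "\<forall>\<^sub>F n in sequentially. a < prob {\<omega> \<in> space M. ereal \<epsilon> < \<bar>Z n \<omega>\<bar>}"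
      by (intro always_eventually) (auto intro: less_le_trans)
  qed
qed

lemma mostly_bounded_expectation:
  fixes W :: "nat \<Rightarrow> 'a \<Rightarrow> real"
  assumes int: "\<And>n. 1 \<le> n \<Longrightarrow> integrable M (W n)" and nn: "\<And>n \<omega>. 1 \<le> n \<Longrightarrow> 0 \<le> W n \<omega>"
    and le: "\<And>n. 1 \<le> n \<Longrightarrow> expectation (W n) \<le> c" and \<eta>: "0 < \<eta>"
  obtains k where "0 < k" "mostly M \<eta> (\<lambda>n \<omega>. W n \<omega> \<le> k)"
proof -
  \<comment> \<open>Markov's inequality then gives probability at most \<eta>/2; the term |c| + 1
    keeps k positive whatever the sign of c.\<close>
  define k where "k = 2 * (\<bar>c\<bar> + 1) / \<eta>"
  have k: "0 < k" using \<eta> by (simp add: k_def)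
  have "mostly M \<eta> (\<lambda>n \<omega>. W n \<omega> \<le> k)"
    unfolding mostly_def using eventually_ge_at_top[of 1]
  proof eventually_elim
    case (elim n)
    have [measurable]: "W n \<in> borel_measurable M" using int[OF elim] by simp
    have "prob {\<omega> \<in> space M. k \<le> W n \<omega>} \<le> expectation (W n) / k"
      using int[OF elim] nn[OF elim] k by (intro integral_Markov_inequality_measure[where A="space M"]) auto
    also have "\<dots> \<le> (\<bar>c\<bar> + 1) / k" using le[OF elim] k by (intro divide_right_mono) auto
    also have "\<dots> < \<eta>" using \<eta> by (simp add: k_def field_simps add_pos_nonneg)
    finally show ?case by (intro bexI[of _ "{\<omega> \<in> space M. k \<le> W n \<omega>}"]) auto
  qed
  with k show thesis by (rule that)
qed

text \<open>Pythagoras in L^2: the cross terms vanish, the order i > j being reduced to i < j by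
  symmetry of the inner product.\<close>

lemma second_moment_orthogonal_sum_le:
  fixes \<psi> :: "nat \<Rightarrow> 'a \<Rightarrow> 'b::real_inner"
  assumes int: "\<And>i j. i \<in> J \<Longrightarrow> j \<in> J \<Longrightarrow> integrable M (\<lambda>\<omega>. \<psi> i \<omega> \<bullet> \<psi> j \<omega>)"
    and orth: "\<And>i j. i \<in> J \<Longrightarrow> j \<in> J \<Longrightarrow> i < j \<Longrightarrow> expectation (\<lambda>\<omega>. \<psi> i \<omega> \<bullet> \<psi> j \<omega>) = 0"
    and le: "\<And>j. j \<in> J \<Longrightarrow> expectation (\<lambda>\<omega>. \<psi> j \<omega> \<bullet> \<psi> j \<omega>) \<le> c" and J: "finite J"
  shows "integrable M (\<lambda>\<omega>. (\<Sum>j\<in>J. \<psi> j \<omega>) \<bullet> (\<Sum>j\<in>J. \<psi> j \<omega>))"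
    and "expectation (\<lambda>\<omega>. (\<Sum>j\<in>J. \<psi> j \<omega>) \<bullet> (\<Sum>j\<in>J. \<psi> j \<omega>)) \<le> real (card J) * c"
proof -
  show "integrable M (\<lambda>\<omega>. (\<Sum>j\<in>J. \<psi> j \<omega>) \<bullet> (\<Sum>j\<in>J. \<psi> j \<omega>))"
    unfolding inner_sum_left inner_sum_right by (intro Bochner_Integration.integrable_sum int)
  have zero: "expectation (\<lambda>\<omega>. \<psi> i \<omega> \<bullet> \<psi> j \<omega>) = 0" if "i \<in> J" "j \<in> J" "i \<noteq> j" for i j
    using that orth[of i j] orth[of j i] by (cases "i < j") (auto simp: inner_commute)
  have "expectation (\<lambda>\<omega>. (\<Sum>j\<in>J. \<psi> j \<omega>) \<bullet> (\<Sum>j\<in>J. \<psi> j \<omega>))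
      = (\<Sum>j\<in>J. \<Sum>i\<in>J. expectation (\<lambda>\<omega>. \<psi> i \<omega> \<bullet> \<psi> j \<omega>))"
    unfolding inner_sum_left inner_sum_right
    by (subst Bochner_Integration.integral_sum, intro Bochner_Integration.integrable_sum int, assumption+)
      (intro sum.cong refl Bochner_Integration.integral_sum int)
  also have "\<dots> = (\<Sum>j\<in>J. \<Sum>i\<in>J. if i = j then expectation (\<lambda>\<omega>. \<psi> j \<omega> \<bullet> \<psi> j \<omega>) else 0)"
    by (intro sum.cong refl) (auto simp: zero)
  also have "\<dots> = (\<Sum>j\<in>J. expectation (\<lambda>\<omega>. \<psi> j \<omega> \<bullet> \<psi> j \<omega>))" using J by simp
  also have "\<dots> \<le> real (card J) * c" using sum_bounded_above[of J _ c] le by simp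
  finally show "expectation (\<lambda>\<omega>. (\<Sum>j\<in>J. \<psi> j \<omega>) \<bullet> (\<Sum>j\<in>J. \<psi> j \<omega>)) \<le> real (card J) * c" .
qed

end

section \<open>Generated and conditioning \<sigma>-algebras\<close>

lemma space_generated [simp]: "space (generated M Z I) = space M"
  by (simp add: generated_def space_measure_of_conv)

lemma sets_generated:
  "sets (generated M Z I) = sigma_sets (space M) (\<Union>i\<in>I. {Z i -` B \<inter> space M | B. B \<in> sets borel})"
  unfolding generated_def by (rule sets_measure_of) auto

lemma measurable_generated: "i \<in> I \<Longrightarrow> Z i \<in> borel_measurable (generated M Z I)"
  by (rule measurableI) (auto simp: sets_generated)

lemma sets_generated_le:
  assumes "\<And>i. i \<in> I \<Longrightarrow> Z i \<in> borel_measurable M"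
  shows "sets (generated M Z I) \<subseteq> sets M"
  unfolding sets_generated by (rule sets.sigma_sets_subset) (use assms in \<open>auto intro: measurable_sets\<close>)

lemma space_pre_response [simp]: "space (pre_response M X Y j) = space M"
  by (simp add: pre_response_def space_measure_of_conv)

lemma sets_pre_response:
  fixes M :: "'w measure" and X :: "nat \<Rightarrow> 'w \<Rightarrow> real ^ 'p" and Y :: "nat \<Rightarrow> 'w \<Rightarrow> real"
  shows "sets (pre_response M X Y j)
    = sigma_sets (space M) (sets (generated M (zeta X Y) {1..j - 1}) \<union> sets (generated M X {j}))"
proof -
  have "sets (generated M (zeta X Y) {1..j - 1}) \<subseteq> Pow (space M)" "sets (generated M X {j}) \<subseteq> Pow (space M)"
    using sets.space_closed[of "generated M (zeta X Y) {1..j - 1}"] sets.space_closed[of "generated M X {j}"]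
    by simp_all
  then show ?thesis unfolding pre_response_def by (intro sets_measure_of) (rule Un_least)
qed

lemma measurable_zeta:
  assumes "X i \<in> borel_measurable M" "Y i \<in> borel_measurable M"
  shows "zeta X Y i \<in> borel_measurable M"
  unfolding zeta_def[abs_def] using assms by measurable

lemma subalgebra_pre_response:
  fixes M :: "'w measure" and X :: "nat \<Rightarrow> 'w \<Rightarrow> real ^ 'p" and Y :: "nat \<Rightarrow> 'w \<Rightarrow> real"
  assumes "\<And>i. 1 \<le> i \<Longrightarrow> X i \<in> borel_measurable M" "\<And>i. 1 \<le> i \<Longrightarrow> Y i \<in> borel_measurable M" "1 \<le> j"
  shows "subalgebra M (pre_response M X Y j)"
proof -
  have "sets (generated M (zeta X Y) {1..j - 1}) \<subseteq> sets M"
    using assms by (intro sets_generated_le measurable_zeta) auto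
  moreover have "sets (generated M X {j}) \<subseteq> sets M"
    using assms by (intro sets_generated_le) auto
  ultimately show ?thesis
    by (simp add: subalgebra_def sets_pre_response sets.sigma_sets_subset)
qed

lemma measurable_X_pre_response:
  fixes M :: "'w measure" and X :: "nat \<Rightarrow> 'w \<Rightarrow> real ^ 'p" and Y :: "nat \<Rightarrow> 'w \<Rightarrow> real"
  shows "X j \<in> borel_measurable (pre_response M X Y j)"
proof (rule measurableI)
  fix A :: "(real ^ 'p) set" assume "A \<in> sets borel"
  then have "X j -` A \<inter> space M \<in> sets (generated M X {j})"
    using measurable_sets[OF measurable_generated[of j "{j}" X M]] by fastforce
  then show "X j -` A \<inter> space (pre_response M X Y j) \<in> sets (pre_response M X Y j)"
    by (auto simp: sets_pre_response)
qed simp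

text \<open>The past is generated by pairs, from which each component is recovered by a continuous
  projection.\<close>

lemma measurable_past_pre_response:
  fixes M :: "'w measure" and X :: "nat \<Rightarrow> 'w \<Rightarrow> real ^ 'p" and Y :: "nat \<Rightarrow> 'w \<Rightarrow> real"
  assumes "1 \<le> i" "i < j"
  shows "X i \<in> borel_measurable (pre_response M X Y j)" "Y i \<in> borel_measurable (pre_response M X Y j)"
proof -
  let ?G = "generated M (zeta X Y) {1..j - 1}"
  have "zeta X Y i \<in> borel_measurable ?G" using assms by (intro measurable_generated) auto
  moreover have "sets ?G \<subseteq> sets (pre_response M X Y j)" by (auto simp: sets_pre_response)
  ultimately have z: "zeta X Y i \<in> borel_measurable (pre_response M X Y j)"
    by (auto simp: measurable_def)
  have "(\<lambda>\<omega>. fst (zeta X Y i \<omega>)) \<in> borel_measurable (pre_response M X Y j)"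
    by (rule borel_measurable_continuous_on[OF _ z]) (intro continuous_intros)
  then show "X i \<in> borel_measurable (pre_response M X Y j)" by (simp add: zeta_def)
  have "(\<lambda>\<omega>. snd (zeta X Y i \<omega>)) \<in> borel_measurable (pre_response M X Y j)"
    by (rule borel_measurable_continuous_on[OF _ z]) (intro continuous_intros)
  then show "Y i \<in> borel_measurable (pre_response M X Y j)" by (simp add: zeta_def)
qed

section \<open>Elementary inequalities for powers\<close>

lemma rpow_mult_power:
  assumes "0 \<le> x" "0 \<le> a"
  shows "rpow x a * x ^ m = rpow x (a + real m)"
  using assms by (cases "x = 0"; cases "m = 0") (auto simp: rpow_def powr_add powr_realpow)

text \<open>Below 1 the power is at most 1, above 1 it increases with the exponent. All lower
  moments are thereby controlled by the one of highest order.\<close>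

lemma rpow_le_Suc:
  assumes "0 \<le> x" "0 \<le> a" "a \<le> d"
  shows "rpow x a \<le> 1 + rpow x d"
proof (cases "x \<le> 1")
  case True
  then have "rpow x a \<le> 1" using assms by (auto simp: rpow_def powr_le1)
  then show ?thesis using rpow_nonneg[of x d] by linarith
next
  case False
  then have "rpow x a \<le> rpow x d" using assms by (auto simp: rpow_def intro: powr_mono ge_one_powr_ge_zero)
  then show ?thesis by linarith
qed

lemma rpow_mult_base: "0 \<le> x \<Longrightarrow> 0 \<le> y \<Longrightarrow> rpow (x * y) a = rpow x a * rpow y a"
  by (simp add: rpow_def powr_mult)

lemma borel_measurable_rpow [measurable]: "(\<lambda>x. rpow x a) \<in> borel_measurable borel"
  unfolding rpow_def by measurable

lemma square_le_Suc_cube: "0 \<le> (t::real) \<Longrightarrow> t\<^sup>2 \<le> 1 + t ^ 3"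
proof (cases "t \<le> 1")
  case True
  assume "0 \<le> t"
  with True have "t\<^sup>2 \<le> 1" "0 \<le> t ^ 3" by (auto simp: power_le_one)
  then show ?thesis by linarith
next
  case False
  then have "t\<^sup>2 \<le> t ^ 3" by (intro power_increasing) auto
  then show ?thesis by linarith
qed

lemma abs_mult_le_squares: "\<bar>a * c\<bar> \<le> a\<^sup>2 + (c::real)\<^sup>2"
proof -
  have "2 * \<bar>a * c\<bar> \<le> a\<^sup>2 + c\<^sup>2" using sum_squares_bound[of "\<bar>a\<bar>" "\<bar>c\<bar>"] by (simp add: abs_mult)
  then show ?thesis by linarith
qed

section \<open>Moments and the martingale part of the score\<close>

text \<open>The exponent \<open>d\<close> is the order of the available moment of |X|. The bound C'
  + 3 \<le> d covers |X|^3 times the conditional third moment of Y.\<close>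

locale response_moments = prob_space M
  for M :: "'w measure" +
  fixes X :: "nat \<Rightarrow> 'w \<Rightarrow> real ^ 'p" and Y :: "nat \<Rightarrow> 'w \<Rightarrow> real" and F :: "real ^ 'p \<Rightarrow> real"
    and C' K d :: real
  assumes X: "\<And>j. j \<ge> 1 \<Longrightarrow> X j \<in> borel_measurable M"
    and Y: "\<And>j. j \<ge> 1 \<Longrightarrow> Y j \<in> borel_measurable M"
    and exponents: "C' \<ge> 0" "K > 0" "C' + 3 \<le> d"
    and Y_cond: "\<And>j. j \<ge> 1 \<Longrightarrow> AE \<omega> in M.
        nn_cond_exp M (pre_response M X Y j) (\<lambda>\<omega>. ennreal (\<bar>Y j \<omega>\<bar> ^ 3)) \<omega>
          \<le> ennreal (K * (1 + rpow (norm (X j \<omega>)) C'))"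
    and X_moment: "(SUP j\<in>{1..}. \<integral>\<^sup>+ \<omega>. ennreal (rpow (norm (X j \<omega>)) d) \<partial>M) < \<infinity>"
    and F: "F \<in> borel_measurable borel"
    and mean: "\<And>j. j \<ge> 1 \<Longrightarrow> AE \<omega> in M. real_cond_exp M (pre_response M X Y j) (Y j) \<omega> = F (X j \<omega>)"
begin

definition moment_bound :: real where
  "moment_bound = enn2real (SUP j\<in>{1..}. \<integral>\<^sup>+ \<omega>. ennreal (rpow (norm (X j \<omega>)) d) \<partial>M)"

lemma sigma_finite_pre_response: "1 \<le> j \<Longrightarrow> sigma_finite_subalgebra M (pre_response M X Y j)"
  by (intro finite_measure_subalgebra_is_sigma_finite finite_measure_subalgebra.intro
      finite_measure_subalgebra_axioms.intro subalgebra_pre_response finite_measure_axioms X Y) auto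

lemma X_norm_moment:
  assumes j: "1 \<le> j"
  shows "integrable M (\<lambda>\<omega>. rpow (norm (X j \<omega>)) d)"
    and "expectation (\<lambda>\<omega>. rpow (norm (X j \<omega>)) d) \<le> moment_bound"
proof -
  have [measurable]: "X j \<in> borel_measurable M" by (rule X[OF j])
  have le: "(\<integral>\<^sup>+ \<omega>. ennreal (rpow (norm (X j \<omega>)) d) \<partial>M)
      \<le> (SUP j\<in>{1..}. \<integral>\<^sup>+ \<omega>. ennreal (rpow (norm (X j \<omega>)) d) \<partial>M)"
    using j by (intro SUP_upper) auto
  show int: "integrable M (\<lambda>\<omega>. rpow (norm (X j \<omega>)) d)"
    by (intro integrableI_nonneg) (use le X_moment in \<open>auto simp: rpow_nonneg\<close>)
  have "ennreal (expectation (\<lambda>\<omega>. rpow (norm (X j \<omega>)) d)) \<le> ennreal moment_bound"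
    using le X_moment int
    by (subst nn_integral_eq_integral[symmetric]) (auto simp: rpow_nonneg moment_bound_def)
  then show "expectation (\<lambda>\<omega>. rpow (norm (X j \<omega>)) d) \<le> moment_bound"
    by (simp add: moment_bound_def)
qed

text \<open>A power of |X| is measurable for the conditioning \<sigma>-algebra and moves inside the
  conditional expectation of |Y|^3. Working with nonnegative integrals permits this before
  integrability is known.\<close>

lemma Y_cube_moment:
  assumes j: "1 \<le> j" and q: "q \<le> 3"
  shows "integrable M (\<lambda>\<omega>. norm (X j \<omega>) ^ q * \<bar>Y j \<omega>\<bar> ^ 3)"
    and "expectation (\<lambda>\<omega>. norm (X j \<omega>) ^ q * \<bar>Y j \<omega>\<bar> ^ 3) \<le> 2 * K * (1 + moment_bound)"
proof -
  interpret S: sigma_finite_subalgebra M "pre_response M X Y j" by (rule sigma_finite_pre_response[OF j])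
  have [measurable]: "X j \<in> borel_measurable M" "Y j \<in> borel_measurable M"
    using X[OF j] Y[OF j] by auto
  have meas: "(\<lambda>\<omega>. ennreal (norm (X j \<omega>) ^ q)) \<in> borel_measurable (pre_response M X Y j)"
    using measurable_X_pre_response[of X j M Y] by measurable
  \<comment> \<open>The factor 2 arises from bounding the powers q and q + C' of the norm separately
    by 1 plus the power d.\<close>
  let ?R = "\<lambda>\<omega>. 2 * K * (1 + rpow (norm (X j \<omega>)) d)"
  have intR: "integrable M ?R" using X_norm_moment(1)[OF j] by simp
  have "(\<integral>\<^sup>+ \<omega>. ennreal (norm (X j \<omega>) ^ q * \<bar>Y j \<omega>\<bar> ^ 3) \<partial>M)
      = (\<integral>\<^sup>+ \<omega>. ennreal (norm (X j \<omega>) ^ q) * ennreal (\<bar>Y j \<omega>\<bar> ^ 3) \<partial>M)"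
    by (intro nn_integral_cong) (simp add: ennreal_mult)
  also have "\<dots> = (\<integral>\<^sup>+ \<omega>. ennreal (norm (X j \<omega>) ^ q) *
      nn_cond_exp M (pre_response M X Y j) (\<lambda>\<omega>. ennreal (\<bar>Y j \<omega>\<bar> ^ 3)) \<omega> \<partial>M)"
    by (rule S.nn_cond_exp_intg[OF meas, symmetric]) measurable
  also have "\<dots> \<le> (\<integral>\<^sup>+ \<omega>. ennreal (?R \<omega>) \<partial>M)"
  proof (rule nn_integral_mono_AE)
    show "AE \<omega> in M. ennreal (norm (X j \<omega>) ^ q) *
        nn_cond_exp M (pre_response M X Y j) (\<lambda>\<omega>. ennreal (\<bar>Y j \<omega>\<bar> ^ 3)) \<omega> \<le> ennreal (?R \<omega>)"
      using Y_cond[OF j]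
    proof eventually_elim
      case (elim \<omega>)
      let ?x = "norm (X j \<omega>)"
      have 1: "?x ^ q \<le> 1 + rpow ?x d"
        using rpow_mult_power[of ?x 0 q] rpow_le_Suc[of ?x "real q" d] q exponents by (simp add: rpow_def)
      have 2: "rpow ?x C' * ?x ^ q \<le> 1 + rpow ?x d"
        using rpow_le_Suc[of ?x "C' + real q" d] q exponents by (simp add: rpow_mult_power)
      have "?x ^ q * (K * (1 + rpow ?x C')) = K * (?x ^ q + rpow ?x C' * ?x ^ q)"
        by (simp add: algebra_simps)
      also have "\<dots> \<le> K * (2 * (1 + rpow ?x d))" using 1 2 exponents by (intro mult_left_mono) auto
      finally have "?x ^ q * (K * (1 + rpow ?x C')) \<le> ?R \<omega>" by (simp add: mult_ac)
      then have "ennreal (?x ^ q) * ennreal (K * (1 + rpow ?x C')) \<le> ennreal (?R \<omega>)"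
        using exponents by (subst ennreal_mult[symmetric]) (auto simp: rpow_nonneg intro!: mult_nonneg_nonneg add_nonneg_nonneg)
      then show ?case using elim by (meson mult_left_mono order_trans zero_le)
    qed
  qed
  also have "\<dots> = ennreal (expectation ?R)"
    using intR exponents by (intro nn_integral_eq_integral) (auto simp: rpow_nonneg)
  finally have le: "(\<integral>\<^sup>+ \<omega>. ennreal (norm (X j \<omega>) ^ q * \<bar>Y j \<omega>\<bar> ^ 3) \<partial>M) \<le> ennreal (expectation ?R)" .
  show int: "integrable M (\<lambda>\<omega>. norm (X j \<omega>) ^ q * \<bar>Y j \<omega>\<bar> ^ 3)"
    by (intro integrableI_nonneg) (use le in \<open>auto intro: le_less_trans\<close>)
  have "expectation (\<lambda>\<omega>. norm (X j \<omega>) ^ q * \<bar>Y j \<omega>\<bar> ^ 3) \<le> expectation ?R"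
    using le int exponents
    by (subst (asm) nn_integral_eq_integral) (auto simp: rpow_nonneg intro!: Bochner_Integration.integral_nonneg)
  also have "\<dots> = 2 * K * (1 + expectation (\<lambda>\<omega>. rpow (norm (X j \<omega>)) d))"
    using X_norm_moment(1)[OF j] by (simp add: prob_space)
  also have "\<dots> \<le> 2 * K * (1 + moment_bound)"
    using X_norm_moment(2)[OF j] exponents by (intro mult_left_mono) auto
  finally show "expectation (\<lambda>\<omega>. norm (X j \<omega>) ^ q * \<bar>Y j \<omega>\<bar> ^ 3) \<le> 2 * K * (1 + moment_bound)" .
qed

lemma XY_square_moment:
  assumes j: "1 \<le> j"
  shows "integrable M (\<lambda>\<omega>. (norm (X j \<omega>) * Y j \<omega>)\<^sup>2)"
    and "expectation (\<lambda>\<omega>. (norm (X j \<omega>) * Y j \<omega>)\<^sup>2) \<le> 1 + 2 * K * (1 + moment_bound)"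
proof -
  have [measurable]: "X j \<in> borel_measurable M" "Y j \<in> borel_measurable M"
    using X[OF j] Y[OF j] by auto
  let ?R = "\<lambda>\<omega>. 1 + norm (X j \<omega>) ^ 3 * \<bar>Y j \<omega>\<bar> ^ 3"
  have int: "integrable M ?R" using Y_cube_moment(1)[OF j, of 3] by simp
  have le: "(norm (X j \<omega>) * Y j \<omega>)\<^sup>2 \<le> ?R \<omega>" for \<omega>
    using square_le_Suc_cube[of "norm (X j \<omega>) * \<bar>Y j \<omega>\<bar>"] by (simp add: power_mult_distrib)
  show int': "integrable M (\<lambda>\<omega>. (norm (X j \<omega>) * Y j \<omega>)\<^sup>2)"
    by (rule Bochner_Integration.integrable_bound[OF int]) (use le in \<open>auto intro!: AE_I2\<close>)
  have "expectation (\<lambda>\<omega>. (norm (X j \<omega>) * Y j \<omega>)\<^sup>2) \<le> expectation ?R"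
    by (intro integral_mono int int' le)
  also have "\<dots> \<le> 1 + 2 * K * (1 + moment_bound)"
    using Y_cube_moment[OF j, of 3] by (simp add: prob_space)
  finally show "expectation (\<lambda>\<omega>. (norm (X j \<omega>) * Y j \<omega>)\<^sup>2) \<le> 1 + 2 * K * (1 + moment_bound)" .
qed

text \<open>No growth condition on F is at hand; its moments are inherited from Y, whose conditional
  mean it is.\<close>

lemma FX_square_moment:
  assumes j: "1 \<le> j"
  shows "integrable M (\<lambda>\<omega>. (norm (X j \<omega>) * F (X j \<omega>))\<^sup>2)"
    and "expectation (\<lambda>\<omega>. (norm (X j \<omega>) * F (X j \<omega>))\<^sup>2) \<le> 1 + 2 * K * (1 + moment_bound)"
proof -
  interpret S: sigma_finite_subalgebra M "pre_response M X Y j" by (rule sigma_finite_pre_response[OF j])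
  have [measurable]: "X j \<in> borel_measurable M" "Y j \<in> borel_measurable M" "F \<in> borel_measurable borel"
    using X[OF j] Y[OF j] F by auto
  let ?U = "\<lambda>\<omega>. norm (X j \<omega>) * Y j \<omega>"
  let ?E = "real_cond_exp M (pre_response M X Y j)"
  note U2 = XY_square_moment[OF j]
  have U: "integrable M ?U"
  proof (rule square_integrable_imp_integrable)
    show "?U \<in> borel_measurable M" by measurable
    show "integrable M (\<lambda>\<omega>. (?U \<omega>)\<^sup>2)" by (rule U2(1))
  qed
  have "(\<lambda>\<omega>. norm (X j \<omega>)) \<in> borel_measurable (pre_response M X Y j)"
    using measurable_X_pre_response[of X j M Y] by measurable
  from S.real_cond_exp_mult[OF this _ U]
  have "AE \<omega> in M. ?E ?U \<omega> = norm (X j \<omega>) * ?E (Y j) \<omega>" by simp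
  with mean[OF j] have eq: "AE \<omega> in M. ?E ?U \<omega> = norm (X j \<omega>) * F (X j \<omega>)" by eventually_elim simp
  \<comment> \<open>\<open>F(X\<^sub>j) \<bar>X\<^sub>j\<bar>\<close> is the conditional expectation of \<open>Y\<^sub>j \<bar>X\<^sub>j\<bar>\<close>, so Jensen's inequality applies.\<close>
  have "AE \<omega> in M. (?E ?U \<omega>)\<^sup>2 \<le> ?E (\<lambda>\<omega>. (?U \<omega>)\<^sup>2) \<omega>"
  proof (rule S.real_cond_exp_jensens_inequality(2)[OF U, where I=UNIV and q="\<lambda>x. x\<^sup>2"])
    show "integrable M (\<lambda>\<omega>. (?U \<omega>)\<^sup>2)" by (rule U2(1))
    show "convex_on UNIV (\<lambda>x::real. x\<^sup>2)" by (rule convex_power2)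
    show "(\<lambda>x::real. x\<^sup>2) \<in> borel_measurable borel" by measurable
  qed simp_all
  with eq have le: "AE \<omega> in M. (norm (X j \<omega>) * F (X j \<omega>))\<^sup>2 \<le> ?E (\<lambda>\<omega>. (?U \<omega>)\<^sup>2) \<omega>"
    by eventually_elim simp
  note intE = S.real_cond_exp_int[OF U2(1)]
  show int: "integrable M (\<lambda>\<omega>. (norm (X j \<omega>) * F (X j \<omega>))\<^sup>2)"
    by (rule Bochner_Integration.integrable_bound[OF intE(1)]) (use le in \<open>auto elim!: eventually_mono\<close>)
  have "expectation (\<lambda>\<omega>. (norm (X j \<omega>) * F (X j \<omega>))\<^sup>2) \<le> expectation (?E (\<lambda>\<omega>. (?U \<omega>)\<^sup>2))"
    by (intro integral_mono_AE int intE(1) le)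
  also have "\<dots> \<le> 1 + 2 * K * (1 + moment_bound)" using intE(2) U2(2) by simp
  finally show "expectation (\<lambda>\<omega>. (norm (X j \<omega>) * F (X j \<omega>))\<^sup>2) \<le> 1 + 2 * K * (1 + moment_bound)" .
qed

text \<open>The martingale increment of the score: what remains of a summand at
  \<open>\<theta>\<^sub>0\<close> is (F(X) - b'(X'\<open>\<theta>\<^sub>0\<close>)) X, the part
  bounded in probability by hypothesis.\<close>

definition noise :: "nat \<Rightarrow> 'w \<Rightarrow> real ^ 'p" where
  "noise j \<omega> = (Y j \<omega> - F (X j \<omega>)) *\<^sub>R X j \<omega>"

lemma measurable_noise: "1 \<le> j \<Longrightarrow> noise j \<in> borel_measurable M"
  unfolding noise_def[abs_def] using X[of j] Y[of j] F by measurable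

lemma noise_square_moment:
  assumes j: "1 \<le> j"
  shows "integrable M (\<lambda>\<omega>. (norm (noise j \<omega>))\<^sup>2)"
    and "expectation (\<lambda>\<omega>. (norm (noise j \<omega>))\<^sup>2) \<le> 4 * (1 + 2 * K * (1 + moment_bound))"
proof -
  have [measurable]: "noise j \<in> borel_measurable M" by (rule measurable_noise[OF j])
  let ?R = "\<lambda>\<omega>. 2 * (norm (X j \<omega>) * Y j \<omega>)\<^sup>2 + 2 * (norm (X j \<omega>) * F (X j \<omega>))\<^sup>2"
  note m = XY_square_moment[OF j] FX_square_moment[OF j]
  have int: "integrable M ?R" using m by simp
  have le: "(norm (noise j \<omega>))\<^sup>2 \<le> ?R \<omega>" for \<omega>
  proof -
    have "(a - c)\<^sup>2 \<le> 2 * a\<^sup>2 + 2 * c\<^sup>2" for a c :: real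
      using zero_le_power2[of "a + c"] by (simp add: power2_eq_square algebra_simps)
    from this[of "norm (X j \<omega>) * Y j \<omega>" "norm (X j \<omega>) * F (X j \<omega>)"]
    show ?thesis
      by (simp add: noise_def power_mult_distrib right_diff_distrib[symmetric]
          mult.commute[of "(Y j \<omega> - F (X j \<omega>))\<^sup>2"])
  qed
  show int': "integrable M (\<lambda>\<omega>. (norm (noise j \<omega>))\<^sup>2)"
    by (rule Bochner_Integration.integrable_bound[OF int]) (use le in \<open>auto intro!: AE_I2\<close>)
  have "expectation (\<lambda>\<omega>. (norm (noise j \<omega>))\<^sup>2) \<le> expectation ?R"
    by (intro integral_mono int int' le)
  also have "\<dots> \<le> 4 * (1 + 2 * K * (1 + moment_bound))" using m by simp
  finally show "expectation (\<lambda>\<omega>. (norm (noise j \<omega>))\<^sup>2) \<le> 4 * (1 + 2 * K * (1 + moment_bound))" .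
qed

lemma noise_inner_integrable:
  assumes "1 \<le> i" "1 \<le> j"
  shows "integrable M (\<lambda>\<omega>. noise i \<omega> \<bullet> noise j \<omega>)"
proof -
  have [measurable]: "noise i \<in> borel_measurable M" "noise j \<in> borel_measurable M"
    using assms by (auto intro: measurable_noise)
  have "integrable M (\<lambda>\<omega>. (norm (noise i \<omega>))\<^sup>2 + (norm (noise j \<omega>))\<^sup>2)"
    using noise_square_moment(1) assms by simp
  then show ?thesis
  proof (rule Bochner_Integration.integrable_bound)
    have "\<bar>noise i \<omega> \<bullet> noise j \<omega>\<bar> \<le> (norm (noise i \<omega>))\<^sup>2 + (norm (noise j \<omega>))\<^sup>2" for \<omega>
      using Cauchy_Schwarz_ineq2[of "noise i \<omega>" "noise j \<omega>"]
        abs_mult_le_squares[of "norm (noise i \<omega>)" "norm (noise j \<omega>)"] by simp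
    then show "AE \<omega> in M. norm (noise i \<omega> \<bullet> noise j \<omega>) \<le> norm ((norm (noise i \<omega>))\<^sup>2 + (norm (noise j \<omega>))\<^sup>2)"
      by simp
  qed measurable
qed

lemma noise_orthogonal:
  assumes i: "1 \<le> i" and ij: "i < j"
  shows "expectation (\<lambda>\<omega>. noise i \<omega> \<bullet> noise j \<omega>) = 0"
proof -
  have j: "1 \<le> j" using assms by simp
  interpret S: sigma_finite_subalgebra M "pre_response M X Y j" by (rule sigma_finite_pre_response[OF j])
  have [measurable]: "X i \<in> borel_measurable (pre_response M X Y j)" "Y i \<in> borel_measurable (pre_response M X Y j)"
    "X j \<in> borel_measurable (pre_response M X Y j)" "F \<in> borel_measurable borel"
    using measurable_past_pre_response[OF i ij, where X=X and Y=Y] measurable_X_pre_response F by auto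
  have [measurable]: "X i \<in> borel_measurable M" "Y i \<in> borel_measurable M"
    "X j \<in> borel_measurable M" "Y j \<in> borel_measurable M"
    using X Y i j by auto
  \<comment> \<open>\<open>?Z\<close> is measurable with respect to the conditioning \<open>\<sigma>\<close>-algebra of index j, and the inner product is \<open>?Z (Y\<^sub>j - F(X\<^sub>j))\<close>.\<close>
  let ?Z = "\<lambda>\<omega>. (Y i \<omega> - F (X i \<omega>)) * (X i \<omega> \<bullet> X j \<omega>)"
  have Z: "?Z \<in> borel_measurable (pre_response M X Y j)" by measurable
  \<comment> \<open>Grouping the norm of \<open>X j\<close> with \<open>Y j\<close> leaves two
    square-integrable factors, the other being the norm of \<open>noise i\<close>.\<close>
  have "integrable M (\<lambda>\<omega>. (norm (noise i \<omega>))\<^sup>2 + (norm (X j \<omega>) * Y j \<omega>)\<^sup>2)"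
    using noise_square_moment(1)[OF i] XY_square_moment(1)[OF j] by simp
  then have ZY: "integrable M (\<lambda>\<omega>. ?Z \<omega> * Y j \<omega>)"
  proof (rule Bochner_Integration.integrable_bound)
    have "\<bar>?Z \<omega> * Y j \<omega>\<bar> \<le> (norm (noise i \<omega>))\<^sup>2 + (norm (X j \<omega>) * Y j \<omega>)\<^sup>2" for \<omega>
    proof -
      have "\<bar>?Z \<omega> * Y j \<omega>\<bar> = \<bar>noise i \<omega> \<bullet> X j \<omega>\<bar> * \<bar>Y j \<omega>\<bar>" by (simp add: noise_def abs_mult)
      also have "\<dots> \<le> (norm (noise i \<omega>) * norm (X j \<omega>)) * \<bar>Y j \<omega>\<bar>"
        by (intro mult_right_mono Cauchy_Schwarz_ineq2) auto
      also have "\<dots> = \<bar>norm (noise i \<omega>) * (norm (X j \<omega>) * Y j \<omega>)\<bar>" by (simp add: abs_mult)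
      also have "\<dots> \<le> (norm (noise i \<omega>))\<^sup>2 + (norm (X j \<omega>) * Y j \<omega>)\<^sup>2" by (rule abs_mult_le_squares)
      finally show ?thesis .
    qed
    then show "AE \<omega> in M. norm (?Z \<omega> * Y j \<omega>) \<le> norm ((norm (noise i \<omega>))\<^sup>2 + (norm (X j \<omega>) * Y j \<omega>)\<^sup>2)"
      by simp
  qed measurable
  note ce = S.real_cond_exp_intg[OF ZY Z]
  have AE: "AE \<omega> in M. ?Z \<omega> * real_cond_exp M (pre_response M X Y j) (Y j) \<omega> = ?Z \<omega> * F (X j \<omega>)"
    using mean[OF j] by eventually_elim simp
  have ZF: "integrable M (\<lambda>\<omega>. ?Z \<omega> * F (X j \<omega>))"
    by (rule integrable_cong_AE_imp[OF ce(1)]) (use AE in \<open>auto elim: eventually_mono\<close>)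
  have "expectation (\<lambda>\<omega>. ?Z \<omega> * F (X j \<omega>)) = expectation (\<lambda>\<omega>. ?Z \<omega> * Y j \<omega>)"
    using ce(2) integral_cong_AE[OF _ _ AE] by simp
  moreover have "(\<lambda>\<omega>. noise i \<omega> \<bullet> noise j \<omega>) = (\<lambda>\<omega>. ?Z \<omega> * Y j \<omega> - ?Z \<omega> * F (X j \<omega>))"
    by (simp add: noise_def fun_eq_iff algebra_simps)
  ultimately show ?thesis using ZY ZF by simp
qed

text \<open>Orthogonality makes the second moment of the sum grow at most linearly in n; Markov's
  inequality for the squared norm divided by n then gives the order sqrt(n).\<close>

lemma noise_sum_bounded_in_probability:
  assumes "0 < \<eta>"
  obtains g where "0 < g" "mostly M \<eta> (\<lambda>n \<omega>. norm (\<Sum>j=1..n. noise j \<omega>) \<le> g * sqrt (real n))"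
proof -
  let ?c = "4 * (1 + 2 * K * (1 + moment_bound))"
  let ?S = "\<lambda>n \<omega>. \<Sum>j=1..n. noise j \<omega>"
  let ?W = "\<lambda>n \<omega>. (?S n \<omega> \<bullet> ?S n \<omega>) / real n"
  have orth: "integrable M (\<lambda>\<omega>. ?S n \<omega> \<bullet> ?S n \<omega>)" "expectation (\<lambda>\<omega>. ?S n \<omega> \<bullet> ?S n \<omega>) \<le> real n * ?c" for n
    using second_moment_orthogonal_sum_le[of "{1..n}" noise ?c] noise_square_moment(2)
    by (auto simp: noise_inner_integrable noise_orthogonal power2_norm_eq_inner)
  obtain k where k: "0 < k" "mostly M \<eta> (\<lambda>n \<omega>. ?W n \<omega> \<le> k)"
  proof (rule mostly_bounded_expectation[of ?W ?c \<eta>])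
    show "expectation (?W n) \<le> ?c" if "1 \<le> n" for n
      using orth(2)[of n] that by (simp add: pos_divide_le_eq mult.commute)
  qed (use orth(1) assms in auto)
  have "mostly M \<eta> (\<lambda>n \<omega>. norm (?S n \<omega>) \<le> sqrt k * sqrt (real n))"
  proof (rule mostly_mono[OF k(2)])
    show "\<forall>\<^sub>F n in sequentially. \<forall>\<omega>\<in>space M. ?W n \<omega> \<le> k \<longrightarrow> norm (?S n \<omega>) \<le> sqrt k * sqrt (real n)"
      using eventually_ge_at_top[of 1]
    proof eventually_elim
      case (elim n)
      then show ?case
        by (auto simp: norm_eq_sqrt_inner real_sqrt_mult[symmetric] pos_divide_le_eq)
    qed
  qed
  with k show thesis by (intro that[of "sqrt k"]) auto
qed

lemma average_bounded_in_probability: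
  fixes f :: "real ^ 'p \<Rightarrow> real"
  assumes f: "f \<in> borel_measurable borel" "\<And>x. 0 \<le> f x" "\<And>x. f x \<le> a * (1 + rpow (norm x) d)"
    and \<eta>: "0 < \<eta>"
  obtains k where "0 < k" "mostly M \<eta> (\<lambda>n \<omega>. (1 / real n) * (\<Sum>j=1..n. f (X j \<omega>)) \<le> k)"
proof (rule mostly_bounded_expectation[of "\<lambda>n \<omega>. (1 / real n) * (\<Sum>j=1..n. f (X j \<omega>))" "a * (1 + moment_bound)" \<eta>])
  \<comment> \<open>The two bounds on f at the origin force the sign of \<open>a\<close>.\<close>
  have a: "0 \<le> a" using f(2,3)[of 0] rpow_nonneg[of "norm (0::real^'p)" d]
    by (smt (verit) mult_neg_pos)
  have int: "integrable M (\<lambda>\<omega>. f (X j \<omega>))" and le: "expectation (\<lambda>\<omega>. f (X j \<omega>)) \<le> a * (1 + moment_bound)"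
    if j: "1 \<le> j" for j
  proof -
    have [measurable]: "X j \<in> borel_measurable M" "f \<in> borel_measurable borel" using X[OF j] f by auto
    have R: "integrable M (\<lambda>\<omega>. a * (1 + rpow (norm (X j \<omega>)) d))" using X_norm_moment(1)[OF j] by simp
    show int: "integrable M (\<lambda>\<omega>. f (X j \<omega>))"
      by (rule Bochner_Integration.integrable_bound[OF R])
        (use f(2,3) in \<open>auto intro!: AE_I2 intro: order_trans[OF _ abs_ge_self]\<close>)
    have "expectation (\<lambda>\<omega>. f (X j \<omega>)) \<le> expectation (\<lambda>\<omega>. a * (1 + rpow (norm (X j \<omega>)) d))"
      by (intro integral_mono int R f(3))
    also have "\<dots> = a * (1 + expectation (\<lambda>\<omega>. rpow (norm (X j \<omega>)) d))"
      using X_norm_moment(1)[OF j] by (simp add: prob_space)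
    also have "\<dots> \<le> a * (1 + moment_bound)"
      using X_norm_moment(2)[OF j] a by (intro mult_left_mono) auto
    finally show "expectation (\<lambda>\<omega>. f (X j \<omega>)) \<le> a * (1 + moment_bound)" .
  qed
  show "integrable M (\<lambda>\<omega>. (1 / real n) * (\<Sum>j=1..n. f (X j \<omega>)))" for n
    by (intro integrable_mult_right Bochner_Integration.integrable_sum int) auto
  show "0 \<le> (1 / real n) * (\<Sum>j=1..n. f (X j \<omega>))" for n \<omega>
    by (intro mult_nonneg_nonneg sum_nonneg f(2)) auto
  show "expectation (\<lambda>\<omega>. (1 / real n) * (\<Sum>j=1..n. f (X j \<omega>))) \<le> a * (1 + moment_bound)" if "1 \<le> n" for n
  proof -
    have "expectation (\<lambda>\<omega>. (1 / real n) * (\<Sum>j=1..n. f (X j \<omega>)))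
        = (1 / real n) * (\<Sum>j=1..n. expectation (\<lambda>\<omega>. f (X j \<omega>)))"
      using int by (subst integral_mult_right_zero, subst Bochner_Integration.integral_sum) auto
    also have "\<dots> \<le> (1 / real n) * (\<Sum>j=1..n. a * (1 + moment_bound))"
      by (intro mult_left_mono sum_mono le) auto
    finally show ?thesis using that by simp
  qed
qed (use \<eta> that in auto)

end

section \<open>The Laplace approximation\<close>

text \<open>Half the logarithm of the factor n^p relates the two forms of the expansion, by
  absorbing (p/2) log n.\<close>

lemma det_scaleR: "det (c *\<^sub>R A) = c ^ CARD('p) * det (A :: real ^ 'p ^ 'p)"
  by (simp add: det_def prod.distrib sum_distrib_left mult_ac)

theorem theorem3p2:
  fixes M :: "'w measure"
    and X :: "nat \<Rightarrow> 'w \<Rightarrow> real ^ 'p"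
    and Y :: "nat \<Rightarrow> 'w \<Rightarrow> real"
    and \<Theta> :: "(real ^ 'p) set"
    and b :: "real \<Rightarrow> real"
    and F :: "real ^ 'p \<Rightarrow> real"
    and \<nu> :: "(real ^ 'p) measure"
    and \<theta>\<^sub>0 :: "real ^ 'p"
    and \<theta>hat :: "nat \<Rightarrow> 'w \<Rightarrow> real ^ 'p"
    and b_low :: "real ^ 'p \<Rightarrow> real"
    and prior :: "real ^ 'p \<Rightarrow> real"
    and C C' K c lam\<^sub>0 :: real
  assumes M: "prob_space M"
    and X: "\<And>j. j \<ge> 1 \<Longrightarrow> X j \<in> borel_measurable M"
    and Y: "\<And>j. j \<ge> 1 \<Longrightarrow> Y j \<in> borel_measurable M"
    and Theta: "open \<Theta>" "convex \<Theta>" "bounded \<Theta>"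
    and b: "continuously_differentiable 3 b" "convex_on UNIV b"
    and QMLE: "\<And>n. n \<ge> 1 \<Longrightarrow> \<theta>hat n \<in> M \<rightarrow>\<^sub>M restrict_space borel \<Theta>"
      "\<And>n. n \<ge> 1 \<Longrightarrow> AE \<omega> in M. is_arg_max (quasi_loglik b X Y n \<omega>) (\<lambda>\<theta>. \<theta> \<in> \<Theta>) (\<theta>hat n \<omega>)"
    and A1_const: "C \<ge> 0" "C' \<ge> 0" "K > 0"
    and A1_i: "\<And>x. (MAX i\<in>{1,2,3}. \<bar>(deriv ^^ i) b x\<bar>) \<le> K * (1 + rpow \<bar>x\<bar> C)"
    and A1_ii: "\<And>j. j \<ge> 1 \<Longrightarrow> AE \<omega> in M.
        nn_cond_exp M (pre_response M X Y j) (\<lambda>\<omega>. ennreal (\<bar>Y j \<omega>\<bar> ^ 3)) \<omega>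
          \<le> ennreal (K * (1 + rpow (norm (X j \<omega>)) C'))"
    and A1_iii: "(SUP j\<in>{1..}. \<integral>\<^sup>+ \<omega>. ennreal (rpow (norm (X j \<omega>)) (3 * C + C' + 3)) \<partial>M) < \<infinity>"
    and A2: "F \<in> borel_measurable borel"
      "\<And>j. j \<ge> 1 \<Longrightarrow> AE \<omega> in M. real_cond_exp M (pre_response M X Y j) (Y j) \<omega> = F (X j \<omega>)"
    and A3: "c > 0" "\<And>k. k \<ge> 1 \<Longrightarrow> mixing_coeff M (zeta X Y) k \<le> inverse c * exp (- c * real k)"
    and A4_nu: "prob_space \<nu>" "sets \<nu> = sets borel" "nondegenerate \<nu>"
    and A4_integrable:
      "\<And>\<theta>. \<theta> \<in> \<Theta> \<Longrightarrow> integrable \<nu> (\<lambda>x. F x * (x \<bullet> \<theta>) - b (x \<bullet> \<theta>))"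
      "\<And>\<theta>. \<theta> \<in> \<Theta> \<Longrightarrow> integrable \<nu> (\<lambda>x. (deriv ^^ 2) b (x \<bullet> \<theta>) *\<^sub>R outer x)"
    and A4_i: "\<And>\<theta>. \<theta> \<in> \<Theta> \<Longrightarrow> small_oP M (\<lambda>n \<omega>. ereal
        ((1 / real n) * (\<Sum>j=1..n. F (X j \<omega>) * (X j \<omega> \<bullet> \<theta>) - b (X j \<omega> \<bullet> \<theta>))
          - (\<integral>x. F x * (x \<bullet> \<theta>) - b (x \<bullet> \<theta>) \<partial>\<nu>)))"
    and A4_ii: "\<And>\<theta>. \<theta> \<in> \<Theta> \<Longrightarrow> small_oP M (\<lambda>n \<omega>. ereal (norm
        ((1 / real n) *\<^sub>R (\<Sum>j=1..n. (deriv ^^ 2) b (X j \<omega> \<bullet> \<theta>) *\<^sub>R outer (X j \<omega>))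
          - (\<integral>x. (deriv ^^ 2) b (x \<bullet> \<theta>) *\<^sub>R outer x \<partial>\<nu>))))"
    and theta0: "{\<theta>. is_arg_max (limit_loglik b F \<nu>) (\<lambda>\<theta>. \<theta> \<in> \<Theta>) \<theta>} = {\<theta>\<^sub>0}"
    and A5_i: "\<And>x. b_low x > 0" "\<And>x. (INF \<theta>\<in>\<Theta>. (deriv ^^ 2) b (x \<bullet> \<theta>)) \<ge> b_low x"
    and A5_ii: "lam\<^sub>0 > 0"
      "\<And>n. n \<ge> 1 \<Longrightarrow> {\<omega> \<in> space M.
        lambda_min ((1 / real n) *\<^sub>R (\<Sum>j=1..n. b_low (X j \<omega>) *\<^sub>R outer (X j \<omega>))) < lam\<^sub>0} \<in> sets M"
      "limsup (\<lambda>n. ereal (measure M {\<omega> \<in> space M.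
        lambda_min ((1 / real n) *\<^sub>R (\<Sum>j=1..n. b_low (X j \<omega>) *\<^sub>R outer (X j \<omega>))) < lam\<^sub>0})) = 0"
    and A6: "big_OP M (\<lambda>n \<omega>. (1 / sqrt (real n)) *\<^sub>R
        (\<Sum>j=1..n. (F (X j \<omega>) - deriv b (X j \<omega> \<bullet> \<theta>\<^sub>0)) *\<^sub>R X j \<omega>))"
    and prior: "density_on \<Theta> prior"
    and P1: "prior \<theta>\<^sub>0 > 0" "bdd_above (prior ` \<Theta>)"
    and P2: "\<And>m. m > 0 \<Longrightarrow>
        (\<lambda>n. SUP u\<in>{u. norm u < m}. \<bar>prior (\<theta>\<^sub>0 + u /\<^sub>R sqrt (real n)) - prior \<theta>\<^sub>0\<bar>) \<longlonglongrightarrow> 0"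
    and P3: "small_oP M (\<lambda>n \<omega>. eln (prior (\<theta>hat n \<omega>)) - eln (prior \<theta>\<^sub>0))"
  shows "small_oP M (\<lambda>n \<omega>.
      eln (LINT \<theta>:\<Theta>|lborel. exp (quasi_loglik b X Y n \<omega> \<theta>) * prior \<theta>)
      - (ereal (quasi_loglik b X Y n \<omega> (\<theta>hat n \<omega>)
            - real CARD('p) / 2 * ln (real n) + real CARD('p) / 2 * ln (2 * pi))
          - ereal (1 / 2) * eln (det ((1 / real n) *\<^sub>R obs_info b X n \<omega> (\<theta>hat n \<omega>)))
          + eln (prior (\<theta>hat n \<omega>))))
    \<and> small_oP M (\<lambda>n \<omega>.
      eln (LINT \<theta>:\<Theta>|lborel. exp (quasi_loglik b X Y n \<omega> \<theta>) * prior \<theta>)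
      - (ereal (quasi_loglik b X Y n \<omega> (\<theta>hat n \<omega>) + real CARD('p) / 2 * ln (2 * pi))
          - ereal (1 / 2) * eln (det (obs_info b X n \<omega> (\<theta>hat n \<omega>)))
          + eln (prior (\<theta>hat n \<omega>))))"
proof -
  interpret prob_space M by (rule M)
  have th0: "\<theta>\<^sub>0 \<in> \<Theta>" using theta0 by (auto simp: is_arg_max_def)
  obtain r where r: "0 \<le> r" "\<And>\<theta>. \<theta> \<in> \<Theta> \<Longrightarrow> norm \<theta> \<le> r"
    using Theta(3) by (metis bounded_pos less_imp_le)
  obtain P where P: "\<And>\<theta>. \<theta> \<in> \<Theta> \<Longrightarrow> prior \<theta> \<le> P"
    using P1(2) by (auto simp: bdd_above_def)
  interpret Q: quasi_glm_prior \<Theta> b b_low C K r X Y prior \<theta>\<^sub>0 P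
  proof
    show "(\<lambda>\<theta>. indicator \<Theta> \<theta> * prior \<theta>) \<in> borel_measurable borel"
      using prior by (simp add: density_on_def set_borel_measurable_def)
  qed (use Theta r b A1_const A1_i A5_i th0 prior P P1 P2 in \<open>auto simp: density_on_def\<close>)
  interpret R: response_moments M X Y F C' K "3 * C + C' + 3"
    by unfold_locales (use X Y A1_const A1_ii A1_iii A2 in auto)

  have regular: "\<exists>k g. 0 < k \<and> 0 \<le> g \<and> mostly M \<eta> (\<lambda>n \<omega>. Q.regular lam\<^sub>0 k g \<theta>\<^sub>0 n \<omega> (\<theta>hat n \<omega>))"
    if \<eta>: "0 < \<eta>" for \<eta> :: real
  proof -
    \<comment> \<open>Five exceptional events share the allowance \<eta>: the maximiser, the
      eigenvalue bound, the two parts of the score and the envelope moments.\<close>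
    define \<delta> where "\<delta> = \<eta> / 5"
    have \<delta>: "0 < \<delta>" using \<eta> by (simp add: \<delta>_def)
    let ?low = "\<lambda>n \<omega>. (1 / real n) *\<^sub>R (\<Sum>j=1..n. b_low (X j \<omega>) *\<^sub>R outer (X j \<omega>))"
    let ?V = "\<lambda>n \<omega>. \<Sum>j=1..n. (F (X j \<omega>) - deriv b (X j \<omega> \<bullet> \<theta>\<^sub>0)) *\<^sub>R X j \<omega>"
    let ?f = "\<lambda>x. Q.envelope x * (norm x ^ 2 + norm x ^ 3)"
    have E1: "mostly M \<delta> (\<lambda>n \<omega>. is_arg_max (quasi_loglik b X Y n \<omega>) (\<lambda>\<theta>. \<theta> \<in> \<Theta>) (\<theta>hat n \<omega>))"
      by (rule mostly_AE[OF QMLE(2) \<delta>])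
    have E2: "mostly M \<delta> (\<lambda>n \<omega>. lam\<^sub>0 \<le> lambda_min (?low n \<omega>))"
    proof (rule mostly_sets)
      show "\<forall>\<^sub>F n in sequentially. {\<omega> \<in> space M. \<not> lam\<^sub>0 \<le> lambda_min (?low n \<omega>)} \<in> sets M"
        using eventually_ge_at_top[of 1] by eventually_elim (use A5_ii(2) in \<open>simp add: not_le\<close>)
      have "limsup (\<lambda>n. ereal (prob {\<omega> \<in> space M. lambda_min (?low n \<omega>) < lam\<^sub>0})) < ereal \<delta>"
        using A5_ii(3) \<delta> by simp
      from Limsup_lessD[OF this]
      show "\<forall>\<^sub>F n in sequentially. prob {\<omega> \<in> space M. \<not> lam\<^sub>0 \<le> lambda_min (?low n \<omega>)} < \<delta>"
        by (simp add: not_le)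
    qed
    obtain g1 where g1: "0 < g1" and E3: "mostly M \<delta> (\<lambda>n \<omega>. norm (\<Sum>j=1..n. R.noise j \<omega>) \<le> g1 * sqrt (real n))"
      using R.noise_sum_bounded_in_probability[OF \<delta>] .
    obtain g2 where A6': "\<forall>\<^sub>F n in sequentially.
        prob {\<omega> \<in> space M. g2 < norm ((1 / sqrt (real n)) *\<^sub>R ?V n \<omega>)} < \<delta>"
      using A6 \<delta> unfolding big_OP_def by blast
    have db: "deriv b \<in> borel_measurable borel"
      by (intro borel_measurable_continuous_onI DERIV_continuous_on)
        (rule has_field_derivative_at_within[OF Q.derivs(2)])
    have E4: "mostly M \<delta> (\<lambda>n \<omega>. norm ((1 / sqrt (real n)) *\<^sub>R ?V n \<omega>) \<le> g2)"
    proof (rule mostly_sets)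
      have V: "?V n \<in> borel_measurable M" for n
      proof (rule borel_measurable_sum)
        fix j assume "j \<in> {1..n}"
        then have [measurable]: "X j \<in> borel_measurable M" using X by simp
        note db[measurable] A2(1)[measurable]
        show "(\<lambda>\<omega>. (F (X j \<omega>) - deriv b (X j \<omega> \<bullet> \<theta>\<^sub>0)) *\<^sub>R X j \<omega>) \<in> borel_measurable M"
          by measurable
      qed
      have "(\<lambda>\<omega>. norm ((1 / sqrt (real n)) *\<^sub>R ?V n \<omega>)) \<in> borel_measurable M" for n
        by (rule measurable_compose[OF borel_measurable_scaleR[OF borel_measurable_const V] borel_measurable_norm])
      then show "\<forall>\<^sub>F n in sequentially. {\<omega> \<in> space M. \<not> norm ((1 / sqrt (real n)) *\<^sub>R ?V n \<omega>) \<le> g2} \<in> sets M"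
        unfolding not_le borel_measurable_iff_greater by (intro always_eventually allI) blast
      show "\<forall>\<^sub>F n in sequentially. prob {\<omega> \<in> space M. \<not> norm ((1 / sqrt (real n)) *\<^sub>R ?V n \<omega>) \<le> g2} < \<delta>"
        using A6' by (simp add: not_le)
    qed
    \<comment> \<open>The envelope is K (1 + r^C |x|^C) in product form. Multiplied by |x|^2 and
      |x|^3 it yields two terms without and two with the factor r^C, each power of |x| being at most
      1 + |x|^d with d the order of the assumed moment.\<close>
    obtain k where k: "0 < k" and E5: "mostly M \<delta> (\<lambda>n \<omega>. (1 / real n) * (\<Sum>j=1..n. ?f (X j \<omega>)) \<le> k)"
    proof (rule R.average_bounded_in_probability[of ?f "K * (2 + 2 * rpow r C)" \<delta>])
      show "?f \<in> borel_measurable borel" unfolding Q.envelope_def by measurable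
      show "0 \<le> ?f x" for x by (intro mult_nonneg_nonneg Q.envelope_nonneg) auto
      show "?f x \<le> K * (2 + 2 * rpow r C) * (1 + rpow (norm x) (3 * C + C' + 3))" for x
      proof -
        let ?x = "norm x" and ?d = "3 * C + C' + 3"
        have *: "rpow ?x a * ?x ^ m \<le> 1 + rpow ?x ?d" if "0 \<le> a" "a + real m \<le> ?d" for a m
          using rpow_mult_power[of ?x a m] rpow_le_Suc[of ?x "a + real m" ?d] that by simp
        have 0: "?x ^ 2 \<le> 1 + rpow ?x ?d" "?x ^ 3 \<le> 1 + rpow ?x ?d"
          using *[of 0 2] *[of 0 3] A1_const by (simp_all add: rpow_def)
        have C: "rpow ?x C * ?x ^ 2 \<le> 1 + rpow ?x ?d" "rpow ?x C * ?x ^ 3 \<le> 1 + rpow ?x ?d"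
          using *[of C 2] *[of C 3] A1_const by simp_all
        have "(?x ^ 2 + ?x ^ 3) + rpow r C * (rpow ?x C * ?x ^ 2 + rpow ?x C * ?x ^ 3)
            \<le> 2 * (1 + rpow ?x ?d) + rpow r C * (2 * (1 + rpow ?x ?d))"
          using 0 C rpow_nonneg[of r C] by (intro add_mono mult_left_mono) auto
        then have "K * ((?x ^ 2 + ?x ^ 3) + rpow r C * (rpow ?x C * ?x ^ 2 + rpow ?x C * ?x ^ 3))
            \<le> K * (2 * (1 + rpow ?x ?d) + rpow r C * (2 * (1 + rpow ?x ?d)))"
          using A1_const by (intro mult_left_mono) auto
        then show ?thesis
          by (simp add: Q.envelope_def rpow_mult_base[OF r(1)] algebra_simps)
      qed
    qed (use \<delta> in auto)
    \<comment> \<open>The absolute value makes \<open>g\<close> positive, since the constant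
      \<open>g2\<close> comes without a sign.\<close>
    define g where "g = g1 + \<bar>g2\<bar>"
    have "mostly M (\<delta> + (\<delta> + (\<delta> + (\<delta> + \<delta>)))) (\<lambda>n \<omega>.
        is_arg_max (quasi_loglik b X Y n \<omega>) (\<lambda>\<theta>. \<theta> \<in> \<Theta>) (\<theta>hat n \<omega>) \<and> lam\<^sub>0 \<le> lambda_min (?low n \<omega>) \<and>
        norm (\<Sum>j=1..n. R.noise j \<omega>) \<le> g1 * sqrt (real n) \<and>
        norm ((1 / sqrt (real n)) *\<^sub>R ?V n \<omega>) \<le> g2 \<and> (1 / real n) * (\<Sum>j=1..n. ?f (X j \<omega>)) \<le> k)"
      by (intro mostly_conj E1 E2 E3 E4 E5)
    then have "mostly M (\<delta> + (\<delta> + (\<delta> + (\<delta> + \<delta>)))) (\<lambda>n \<omega>. Q.regular lam\<^sub>0 k g \<theta>\<^sub>0 n \<omega> (\<theta>hat n \<omega>))"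
    proof (rule mostly_mono)
      show "\<forall>\<^sub>F n in sequentially. \<forall>\<omega>\<in>space M.
        is_arg_max (quasi_loglik b X Y n \<omega>) (\<lambda>\<theta>. \<theta> \<in> \<Theta>) (\<theta>hat n \<omega>) \<and> lam\<^sub>0 \<le> lambda_min (?low n \<omega>) \<and>
        norm (\<Sum>j=1..n. R.noise j \<omega>) \<le> g1 * sqrt (real n) \<and>
        norm ((1 / sqrt (real n)) *\<^sub>R ?V n \<omega>) \<le> g2 \<and> (1 / real n) * (\<Sum>j=1..n. ?f (X j \<omega>)) \<le> k \<longrightarrow>
        Q.regular lam\<^sub>0 k g \<theta>\<^sub>0 n \<omega> (\<theta>hat n \<omega>)"
        using eventually_ge_at_top[of 1]
      proof (eventually_elim, intro ballI impI, elim conjE)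
        fix n \<omega> assume n: "(1::nat) \<le> n"
          and am: "is_arg_max (quasi_loglik b X Y n \<omega>) (\<lambda>\<theta>. \<theta> \<in> \<Theta>) (\<theta>hat n \<omega>)"
          and low: "lam\<^sub>0 \<le> lambda_min (?low n \<omega>)"
          and noise: "norm (\<Sum>j=1..n. R.noise j \<omega>) \<le> g1 * sqrt (real n)"
          and V: "norm ((1 / sqrt (real n)) *\<^sub>R ?V n \<omega>) \<le> g2"
          and mom: "(1 / real n) * (\<Sum>j=1..n. ?f (X j \<omega>)) \<le> k"
        have "Q.score n \<omega> \<theta>\<^sub>0 = (\<Sum>j=1..n. R.noise j \<omega>) + ?V n \<omega>"
          by (simp add: Q.score_def R.noise_def sum.distrib[symmetric] scaleR_left_distrib[symmetric])
        moreover have "norm (?V n \<omega>) \<le> \<bar>g2\<bar> * sqrt (real n)"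
        proof -
          have "norm (?V n \<omega>) \<le> g2 * sqrt (real n)" using V n by (simp add: pos_divide_le_eq)
          also have "\<dots> \<le> \<bar>g2\<bar> * sqrt (real n)" by (intro mult_right_mono) auto
          finally show ?thesis .
        qed
        ultimately have "norm (Q.score n \<omega> \<theta>\<^sub>0) \<le> g * sqrt (real n)"
          using norm_triangle_ineq[of "\<Sum>j=1..n. R.noise j \<omega>" "?V n \<omega>"] noise
          by (simp add: g_def distrib_right)
        then show "Q.regular lam\<^sub>0 k g \<theta>\<^sub>0 n \<omega> (\<theta>hat n \<omega>)"
          using am low mom by (auto simp: Q.regular_def is_arg_max_def not_less)
      qed
    qed
    moreover have "\<delta> + (\<delta> + (\<delta> + (\<delta> + \<delta>))) = \<eta>" by (simp add: \<delta>_def)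
    ultimately show ?thesis using k g1 by (intro exI[of _ k] exI[of _ g]) (auto simp: g_def)
  qed

  let ?J = "\<lambda>n \<omega>. LINT \<theta>:\<Theta>|lborel. exp (quasi_loglik b X Y n \<omega> \<theta>) * prior \<theta>"
  let ?H = "\<lambda>n \<omega>. quasi_loglik b X Y n \<omega> (\<theta>hat n \<omega>)"
  \<comment> \<open>The three positivity claims make every \<open>eln\<close> below finite and equal
    to \<open>ln\<close>. Keeping \<open>1 \<le> n\<close> in the event lets the last steps hold for
    all n without a further threshold.\<close>
  have approx: "mostly M \<eta> (\<lambda>n \<omega>. 1 \<le> n \<and> 0 < ?J n \<omega> \<and> 0 < det (Q.info n \<omega> (\<theta>hat n \<omega>)) \<and> 0 < prior (\<theta>hat n \<omega>) \<and>
      \<bar>ln (?J n \<omega>) - (?H n \<omega> - real CARD('p) / 2 * ln (real n) + real CARD('p) / 2 * ln (2 * pi)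
        - 1 / 2 * ln (det (Q.info n \<omega> (\<theta>hat n \<omega>))) + ln (prior (\<theta>hat n \<omega>)))\<bar> \<le> \<epsilon>)"
    if \<epsilon>: "0 < \<epsilon>" and \<eta>: "0 < \<eta>" for \<epsilon> \<eta> :: real
  proof -
    obtain k g where k: "0 < k" "0 \<le> g"
      and reg: "mostly M \<eta> (\<lambda>n \<omega>. Q.regular lam\<^sub>0 k g \<theta>\<^sub>0 n \<omega> (\<theta>hat n \<omega>))"
      using regular[OF \<eta>] by blast
    show ?thesis
      by (rule mostly_mono[OF reg])
        (use Q.log_evidence_approx[OF A5_ii(1) k \<epsilon>] eventually_ge_at_top[of 1] in \<open>eventually_elim, blast\<close>)
  qed
  show ?thesis
  proof (intro conjI small_oP_I)
    fix \<epsilon> \<eta> :: real assume "0 < \<epsilon>" "0 < \<eta>"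
    from approx[OF this] show "mostly M \<eta> (\<lambda>n \<omega>. \<bar>eln (?J n \<omega>)
      - (ereal (?H n \<omega> - real CARD('p) / 2 * ln (real n) + real CARD('p) / 2 * ln (2 * pi))
          - ereal (1 / 2) * eln (det ((1 / real n) *\<^sub>R obs_info b X n \<omega> (\<theta>hat n \<omega>)))
          + eln (prior (\<theta>hat n \<omega>)))\<bar> \<le> ereal \<epsilon>)"
      by (rule mostly_mono) (intro always_eventually allI ballI impI, simp add: eln_def Q.info_def)
  next
    fix \<epsilon> \<eta> :: real assume "0 < \<epsilon>" "0 < \<eta>"
    from approx[OF this] show "mostly M \<eta> (\<lambda>n \<omega>. \<bar>eln (?J n \<omega>)
      - (ereal (?H n \<omega> + real CARD('p) / 2 * ln (2 * pi))
          - ereal (1 / 2) * eln (det (obs_info b X n \<omega> (\<theta>hat n \<omega>)))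
          + eln (prior (\<theta>hat n \<omega>)))\<bar> \<le> ereal \<epsilon>)"
    proof (rule mostly_mono, intro always_eventually allI ballI impI, elim conjE)
      fix n \<omega>
      let ?I = "obs_info b X n \<omega> (\<theta>hat n \<omega>)"
      assume n: "(1::nat) \<le> n" and J: "0 < ?J n \<omega>" and det: "0 < det (Q.info n \<omega> (\<theta>hat n \<omega>))"
        and pr: "0 < prior (\<theta>hat n \<omega>)"
        and le: "\<bar>ln (?J n \<omega>) - (?H n \<omega> - real CARD('p) / 2 * ln (real n) + real CARD('p) / 2 * ln (2 * pi)
          - 1 / 2 * ln (det (Q.info n \<omega> (\<theta>hat n \<omega>))) + ln (prior (\<theta>hat n \<omega>)))\<bar> \<le> \<epsilon>"
      \<comment> \<open>Halving the logarithm of n^p cancels the term -(p/2) log n, so the remainder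
        is literally that of the first expansion.\<close>
      have eq: "det ?I = real n ^ CARD('p) * det (Q.info n \<omega> (\<theta>hat n \<omega>))"
        using n by (simp add: Q.info_def det_scaleR power_divide)
      have "0 < det ?I" using det n by (simp add: eq)
      moreover have "ln (det ?I) = real CARD('p) * ln (real n) + ln (det (Q.info n \<omega> (\<theta>hat n \<omega>)))"
        using det n by (simp add: eq ln_mult ln_realpow)
      ultimately show "\<bar>eln (?J n \<omega>) - (ereal (?H n \<omega> + real CARD('p) / 2 * ln (2 * pi))
          - ereal (1 / 2) * eln (det ?I) + eln (prior (\<theta>hat n \<omega>)))\<bar> \<le> ereal \<epsilon>"
        using J pr le by (simp add: eln_def algebra_simps)
    qed
  qed
qed

end
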